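(* Let $(\mathsf{C},\otimes,\mathbb{1})$ be a monoidal category having all coreflexive equalisers, and let $\mathsf{D}$ be a category enriched, tensored and cotensored over $\mathsf{C}$ having all coreflexive equalisers and all reflexive coequalisers. Let $Q$ be a Hopf comonad on $\mathsf{C}$ that preserves coreflexive equalisers and let $M$ be a monad on $\mathsf{D}$ that preserves reflexive coequalisers. Given a cotensorisation $$\mathsf{Alg}_{\mathsf{D}}(M)\times\mathsf{Cog}_{\mathsf{C}}(Q)^{op}\to\mathsf{Alg}_{\mathsf{D}}(M)$$ of $M$-algebras over the monoidal category of $Q$-coalgebras that lifts the cotensorisation of $\mathsf{D}$ by $\mathsf{C}$, the category of $M$-algebras is enriched, tensored and cotensored over the monoidal category of $Q$-coalgebras (with the given cotensorisation).
   Context: For a comonad $Q$ on $\mathsf{C}$, $\mathsf{Cog}_{\mathsf{C}}(Q)$ denotes the category of $Q$-coalgebras; for a monad $M$ on $\mathsf{D}$, $\mathsf{Alg}_{\mathsf{D}}(M)$ denotes the category of $M$-algebras. A Hopf comonad on a monoidal category $(\mathsf{C},\otimes,\mathbb{1})$ is a comonad $(Q,w,n)$ together with a lax monoidal structure $Q(X)\otimes Q(Y)\to Q(X\otimes Y)$, $\mathbb{1}\to Q(\mathbb{1})$ on $Q$ such that $w:Q\to QQ$ and $n:Q\to\mathrm{Id}$ are monoidal natural transformations. Then $\mathsf{Cog}_{\mathsf{C}}(Q)$ is a monoidal category whose forgetful functor to $\mathsf{C}$ is strict monoidal: the coaction on $V\otimes W$ is $V\otimes W\to Q(V)\otimes Q(W)\to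 Q(V\otimes W)$ and that on $\mathbb{1}$ is $\mathbb{1}\to Q(\mathbb{1})$. A tensorisation of a category $\mathsf{D}$ by a monoidal category $\mathsf{E}$ is a bifunctor $-\boxtimes-:\mathsf{E}\times\mathsf{D}\to\mathsf{D}$ with natural transformations $\mathbb{1}\boxtimes X\to X$ and $(V'\otimes V)\boxtimes X\to V'\boxtimes(V\boxtimes X)$ (not required to be invertible) satisfying the usual associativity and unit coherences. A cotensorisation of $\mathsf{D}$ by $\mathsf{E}$ is a bifunctor $\langle-,-\rangle:\mathsf{D}\times\mathsf{E}^{op}\to\mathsf{D}$ with natural transformations $X\to\langle X,\mathbb{1}\rangle$ and $\langle\langle X,V\rangle,V'\rangle\to\langle X,V\otimes V'\rangle$ making $\mathsf{D}^{op}$ tensored over $\mathsf{E}$ equipped with the transposed tensor product $X\otimes^{tr}Y=Y\otimes X$. A category $\mathsf{D}$ is enriched, tensored and cotensored over $\mathsf{E}$ if it is equipped with bifunctors $-\boxtimes-:\mathsf{E}\times\mathsf{D}\to\mathsf{D}$, $\{-,-\}:\mathsf{D}^{op}\times\mathsf{D}\to\mathsf{E}$, $\langle-,-\rangle:\mathsf{D}\times\mathsf{E}^{op}\to\mathsf{D}$, natural isomorphisms $$\hom_{\mathsf{D}}(V\boxtimes X,Y)\simeq\hom_{\mathsf{E}}(V,\{X,Y\})\simeq\hom_{\mathsf{D}}(X,\langle Y,V\rangle),$$ and a structure of cotensorisation on $\langle-,-\rangle$ (equivalently, through the adjunctions, a structure of tensorisation on $\boxtimes$, or a structure of enrichment on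 $\{-,-\}$, i.e. unital associative compositions $\{Y,Z\}\otimes\{X,Y\}\to\{X,Z\}$, $\mathbb{1}\to\{X,X\}$). A cotensorisation of $M$-algebras by $Q$-coalgebras lifts that of $\mathsf{D}$ by $\mathsf{C}$ if the forgetful functors commute strictly with the bifunctors $\langle-,-\rangle$ and send the structural natural transformations to those of the cotensorisation of $\mathsf{D}$ by $\mathsf{C}$. A coreflexive equaliser is an equaliser of a parallel pair with a common left inverse (retraction); a reflexive coequaliser is a coequaliser of a parallel pair with a common right inverse (section). *)

theory Defs
  imports Main
begin

section \<open>Categories, functors, natural transformations\<close>

record ('o, 'a) cat =
  Obj :: "'o set"
  Arr :: "'a set"
  Dom :: "'a \<Rightarrow> 'o"
  Cod :: "'a \<Rightarrow> 'o"
  Ide :: "'o \<Rightarrow> 'a"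
  Comp :: "'a \<Rightarrow> 'a \<Rightarrow> 'a" (infixl "\<cdot>\<index>" 65)

definition hom :: "('o, 'a) cat \<Rightarrow> 'o \<Rightarrow> 'o \<Rightarrow> 'a set" where
  "hom C X Y = {f \<in> Arr C. Dom C f = X \<and> Cod C f = Y}"

locale category =
  fixes C :: "('o, 'a) cat" (structure)
  assumes dom_obj: "f \<in> Arr C \<Longrightarrow> Dom C f \<in> Obj C"
    and cod_obj: "f \<in> Arr C \<Longrightarrow> Cod C f \<in> Obj C"
    and id_hom: "X \<in> Obj C \<Longrightarrow> Ide C X \<in> hom C X X"
    and comp_hom: "f \<in> hom C X Y \<Longrightarrow> g \<in> hom C Y Z \<Longrightarrow> g \<cdot> f \<in> hom C X Z"
    and comp_id_right: "f \<in> hom C X Y \<Longrightarrow> f \<cdot> Ide C X = f"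
    and comp_id_left: "f \<in> hom C X Y \<Longrightarrow> Ide C Y \<cdot> f = f"
    and comp_assoc: "f \<in> hom C W X \<Longrightarrow> g \<in> hom C X Y \<Longrightarrow> h \<in> hom C Y Z \<Longrightarrow>
      (h \<cdot> g) \<cdot> f = h \<cdot> (g \<cdot> f)"

definition is_inverse :: "('o, 'a) cat \<Rightarrow> 'a \<Rightarrow> 'a \<Rightarrow> bool" where
  "is_inverse C f g \<longleftrightarrow>
    f \<in> Arr C \<and> g \<in> hom C (Cod C f) (Dom C f) \<and>
    g \<cdot>\<^bsub>C\<^esub> f = Ide C (Dom C f) \<and> f \<cdot>\<^bsub>C\<^esub> g = Ide C (Cod C f)"

definition is_iso :: "('o, 'a) cat \<Rightarrow> 'a \<Rightarrow> bool" where
  "is_iso C f \<longleftrightarrow> (\<exists>g. is_inverse C f g)"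

definition inv_arr :: "('o, 'a) cat \<Rightarrow> 'a \<Rightarrow> 'a" where
  "inv_arr C f = (THE g. is_inverse C f g)"

definition op_cat :: "('o, 'a) cat \<Rightarrow> ('o, 'a) cat" where
  "op_cat C = \<lparr>Obj = Obj C, Arr = Arr C, Dom = Cod C, Cod = Dom C, Ide = Ide C,
     Comp = (\<lambda>g f. f \<cdot>\<^bsub>C\<^esub> g)\<rparr>"

definition prod_cat :: "('o, 'a) cat \<Rightarrow> ('p, 'b) cat \<Rightarrow> ('o \<times> 'p, 'a \<times> 'b) cat" where
  "prod_cat C D = \<lparr>Obj = Obj C \<times> Obj D, Arr = Arr C \<times> Arr D,
     Dom = map_prod (Dom C) (Dom D), Cod = map_prod (Cod C) (Cod D),
     Ide = map_prod (Ide C) (Ide D),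
     Comp = (\<lambda>(g, g') (f, f'). (g \<cdot>\<^bsub>C\<^esub> f, g' \<cdot>\<^bsub>D\<^esub> f'))\<rparr>"

record ('o, 'a, 'p, 'b) funct =
  ob :: "'o \<Rightarrow> 'p"
  ar :: "'a \<Rightarrow> 'b"

locale is_functor = source: category C + target: category D
  for C :: "('o, 'a) cat" and D :: "('p, 'b) cat" +
  fixes F :: "('o, 'a, 'p, 'b) funct"
  assumes ob_obj: "X \<in> Obj C \<Longrightarrow> ob F X \<in> Obj D"
    and ar_hom: "f \<in> hom C X Y \<Longrightarrow> ar F f \<in> hom D (ob F X) (ob F Y)"
    and ar_id: "X \<in> Obj C \<Longrightarrow> ar F (Ide C X) = Ide D (ob F X)"
    and ar_comp: "f \<in> hom C X Y \<Longrightarrow> g \<in> hom C Y Z \<Longrightarrow>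
      ar F (g \<cdot>\<^bsub>C\<^esub> f) = ar F g \<cdot>\<^bsub>D\<^esub> ar F f"

definition id_funct :: "('o, 'a, 'o, 'a) funct" where
  "id_funct = \<lparr>ob = (\<lambda>X. X), ar = (\<lambda>f. f)\<rparr>"

definition comp_funct ::
  "('p, 'b, 'q, 'c) funct \<Rightarrow> ('o, 'a, 'p, 'b) funct \<Rightarrow> ('o, 'a, 'q, 'c) funct" where
  "comp_funct G F = \<lparr>ob = (\<lambda>X. ob G (ob F X)), ar = (\<lambda>f. ar G (ar F f))\<rparr>"

locale nat_trans = F: is_functor C D F + G: is_functor C D G
  for C :: "('o, 'a) cat" and D :: "('p, 'b) cat" and F G +
  fixes \<tau> :: "'o \<Rightarrow> 'b"
  assumes component_hom: "X \<in> Obj C \<Longrightarrow> \<tau> X \<in> hom D (ob F X) (ob G X)"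
    and natural: "f \<in> hom C X Y \<Longrightarrow> \<tau> Y \<cdot>\<^bsub>D\<^esub> ar F f = ar G f \<cdot>\<^bsub>D\<^esub> \<tau> X"


section \<open>Coreflexive equalisers and reflexive coequalisers\<close>

definition is_equaliser :: "('o, 'a) cat \<Rightarrow> 'a \<Rightarrow> 'a \<Rightarrow> 'a \<Rightarrow> bool" where
  "is_equaliser C f g e \<longleftrightarrow> (\<exists>E A B.
     f \<in> hom C A B \<and> g \<in> hom C A B \<and> e \<in> hom C E A \<and> f \<cdot>\<^bsub>C\<^esub> e = g \<cdot>\<^bsub>C\<^esub> e \<and>
     (\<forall>Z. \<forall>h \<in> hom C Z A. f \<cdot>\<^bsub>C\<^esub> h = g \<cdot>\<^bsub>C\<^esub> h \<longrightarrow> (\<exists>!k. k \<in> hom C Z E \<and> e \<cdot>\<^bsub>C\<^esub> k = h)))"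

definition is_coequaliser :: "('o, 'a) cat \<Rightarrow> 'a \<Rightarrow> 'a \<Rightarrow> 'a \<Rightarrow> bool" where
  "is_coequaliser C f g q \<longleftrightarrow> (\<exists>A B E.
     f \<in> hom C A B \<and> g \<in> hom C A B \<and> q \<in> hom C B E \<and> q \<cdot>\<^bsub>C\<^esub> f = q \<cdot>\<^bsub>C\<^esub> g \<and>
     (\<forall>Z. \<forall>h \<in> hom C B Z. h \<cdot>\<^bsub>C\<^esub> f = h \<cdot>\<^bsub>C\<^esub> g \<longrightarrow> (\<exists>!k. k \<in> hom C E Z \<and> k \<cdot>\<^bsub>C\<^esub> q = h)))"

definition coreflexive_pair :: "('o, 'a) cat \<Rightarrow> 'a \<Rightarrow> 'a \<Rightarrow> bool" where
  "coreflexive_pair C f g \<longleftrightarrow> (\<exists>A B. f \<in> hom C A B \<and> g \<in> hom C A B \<and>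
     (\<exists>r \<in> hom C B A. r \<cdot>\<^bsub>C\<^esub> f = Ide C A \<and> r \<cdot>\<^bsub>C\<^esub> g = Ide C A))"

definition reflexive_pair :: "('o, 'a) cat \<Rightarrow> 'a \<Rightarrow> 'a \<Rightarrow> bool" where
  "reflexive_pair C f g \<longleftrightarrow> (\<exists>A B. f \<in> hom C A B \<and> g \<in> hom C A B \<and>
     (\<exists>s \<in> hom C B A. f \<cdot>\<^bsub>C\<^esub> s = Ide C B \<and> g \<cdot>\<^bsub>C\<^esub> s = Ide C B))"

definition has_coreflexive_equalisers :: "('o, 'a) cat \<Rightarrow> bool" where
  "has_coreflexive_equalisers C \<longleftrightarrow>
     (\<forall>f g. coreflexive_pair C f g \<longrightarrow> (\<exists>e. is_equaliser C f g e))"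

definition has_reflexive_coequalisers :: "('o, 'a) cat \<Rightarrow> bool" where
  "has_reflexive_coequalisers C \<longleftrightarrow>
     (\<forall>f g. reflexive_pair C f g \<longrightarrow> (\<exists>q. is_coequaliser C f g q))"

definition preserves_coreflexive_equalisers ::
  "('o, 'a) cat \<Rightarrow> ('p, 'b) cat \<Rightarrow> ('o, 'a, 'p, 'b) funct \<Rightarrow> bool" where
  "preserves_coreflexive_equalisers C D F \<longleftrightarrow>
     (\<forall>f g e. coreflexive_pair C f g \<and> is_equaliser C f g e \<longrightarrow>
        is_equaliser D (ar F f) (ar F g) (ar F e))"

definition preserves_reflexive_coequalisers ::
  "('o, 'a) cat \<Rightarrow> ('p, 'b) cat \<Rightarrow> ('o, 'a, 'p, 'b) funct \<Rightarrow> bool" where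
  "preserves_reflexive_coequalisers C D F \<longleftrightarrow>
     (\<forall>f g q. reflexive_pair C f g \<and> is_coequaliser C f g q \<longrightarrow>
        is_coequaliser D (ar F f) (ar F g) (ar F q))"


section \<open>Monoidal categories\<close>

record ('o, 'a) monoidal =
  tensor :: "('o \<times> 'o, 'a \<times> 'a, 'o, 'a) funct"
  unit :: "'o"
  assoc :: "'o \<Rightarrow> 'o \<Rightarrow> 'o \<Rightarrow> 'a"
  lunit :: "'o \<Rightarrow> 'a"
  runit :: "'o \<Rightarrow> 'a"

abbreviation tensor_ob :: "('o, 'a) monoidal \<Rightarrow> 'o \<Rightarrow> 'o \<Rightarrow> 'o" (infixl "\<otimes>\<index>" 70) where
  "X \<otimes>\<^bsub>S\<^esub> Y \<equiv> ob (tensor S) (X, Y)"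

abbreviation tensor_ar :: "('o, 'a) monoidal \<Rightarrow> 'a \<Rightarrow> 'a \<Rightarrow> 'a" (infixl "\<star>\<index>" 70) where
  "f \<star>\<^bsub>S\<^esub> g \<equiv> ar (tensor S) (f, g)"

locale monoidal_category = category C
  for C :: "('o, 'a) cat" (structure) +
  fixes S :: "('o, 'a) monoidal" (structure)
  assumes tensor_functor: "is_functor (prod_cat C C) C (tensor S)"
    and unit_obj: "unit S \<in> Obj C"
    and assoc_hom: "\<lbrakk>X \<in> Obj C; Y \<in> Obj C; Z \<in> Obj C\<rbrakk> \<Longrightarrow>
      assoc S X Y Z \<in> hom C ((X \<otimes>\<^bsub>S\<^esub> Y) \<otimes>\<^bsub>S\<^esub> Z) (X \<otimes>\<^bsub>S\<^esub> (Y \<otimes>\<^bsub>S\<^esub> Z))"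
    and lunit_hom: "X \<in> Obj C \<Longrightarrow> lunit S X \<in> hom C (unit S \<otimes>\<^bsub>S\<^esub> X) X"
    and runit_hom: "X \<in> Obj C \<Longrightarrow> runit S X \<in> hom C (X \<otimes>\<^bsub>S\<^esub> unit S) X"
    and assoc_iso: "\<lbrakk>X \<in> Obj C; Y \<in> Obj C; Z \<in> Obj C\<rbrakk> \<Longrightarrow> is_iso C (assoc S X Y Z)"
    and lunit_iso: "X \<in> Obj C \<Longrightarrow> is_iso C (lunit S X)"
    and runit_iso: "X \<in> Obj C \<Longrightarrow> is_iso C (runit S X)"
    and assoc_natural: "\<lbrakk>f \<in> hom C X X'; g \<in> hom C Y Y'; h \<in> hom C Z Z'\<rbrakk> \<Longrightarrow>
      assoc S X' Y' Z' \<cdot>\<^bsub>C\<^esub> ((f \<star>\<^bsub>S\<^esub> g) \<star>\<^bsub>S\<^esub> h) = (f \<star>\<^bsub>S\<^esub> (g \<star>\<^bsub>S\<^esub> h)) \<cdot>\<^bsub>C\<^esub> assoc S X Y Z"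
    and lunit_natural: "f \<in> hom C X X' \<Longrightarrow>
      lunit S X' \<cdot>\<^bsub>C\<^esub> (Ide C (unit S) \<star>\<^bsub>S\<^esub> f) = f \<cdot>\<^bsub>C\<^esub> lunit S X"
    and runit_natural: "f \<in> hom C X X' \<Longrightarrow>
      runit S X' \<cdot>\<^bsub>C\<^esub> (f \<star>\<^bsub>S\<^esub> Ide C (unit S)) = f \<cdot>\<^bsub>C\<^esub> runit S X"
    and pentagon: "\<lbrakk>W \<in> Obj C; X \<in> Obj C; Y \<in> Obj C; Z \<in> Obj C\<rbrakk> \<Longrightarrow>
      assoc S W X (Y \<otimes>\<^bsub>S\<^esub> Z) \<cdot>\<^bsub>C\<^esub> assoc S (W \<otimes>\<^bsub>S\<^esub> X) Y Z =
      (Ide C W \<star>\<^bsub>S\<^esub> assoc S X Y Z) \<cdot>\<^bsub>C\<^esub> assoc S W (X \<otimes>\<^bsub>S\<^esub> Y) Z \<cdot>\<^bsub>C\<^esub> (assoc S W X Y \<star>\<^bsub>S\<^esub> Ide C Z)"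
    and triangle: "\<lbrakk>X \<in> Obj C; Y \<in> Obj C\<rbrakk> \<Longrightarrow>
      (Ide C X \<star>\<^bsub>S\<^esub> lunit S Y) \<cdot>\<^bsub>C\<^esub> assoc S X (unit S) Y = runit S X \<star>\<^bsub>S\<^esub> Ide C Y"

text \<open>
  Passing to \<open>(X, Y) \<mapsto> Y \<otimes> X\<close> inverts the associator and exchanges the two unitors.
\<close>

definition transposed :: "('o, 'a) cat \<Rightarrow> ('o, 'a) monoidal \<Rightarrow> ('o, 'a) monoidal" where
  "transposed C S = \<lparr>
     tensor = \<lparr>ob = (\<lambda>(X, Y). Y \<otimes>\<^bsub>S\<^esub> X), ar = (\<lambda>(f, g). g \<star>\<^bsub>S\<^esub> f)\<rparr>,
     unit = unit S,
     assoc = (\<lambda>X Y Z. inv_arr C (assoc S Z Y X)),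
     lunit = runit S,
     runit = lunit S\<rparr>"


section \<open>Lax monoidal functors and Hopf comonads\<close>

locale lax_monoidal_functor =
  source: monoidal_category C S + target: monoidal_category D S' + is_functor C D F
  for C :: "('o, 'a) cat" and S :: "('o, 'a) monoidal"
    and D :: "('p, 'b) cat" and S' :: "('p, 'b) monoidal"
    and F :: "('o, 'a, 'p, 'b) funct" +
  fixes \<mu> :: "'o \<Rightarrow> 'o \<Rightarrow> 'b" and \<eta> :: "'b"
  assumes mult_hom: "\<lbrakk>X \<in> Obj C; Y \<in> Obj C\<rbrakk> \<Longrightarrow>
      \<mu> X Y \<in> hom D (ob F X \<otimes>\<^bsub>S'\<^esub> ob F Y) (ob F (X \<otimes>\<^bsub>S\<^esub> Y))"
    and unit_hom: "\<eta> \<in> hom D (unit S') (ob F (unit S))"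
    and mult_natural: "\<lbrakk>f \<in> hom C X X'; g \<in> hom C Y Y'\<rbrakk> \<Longrightarrow>
      \<mu> X' Y' \<cdot>\<^bsub>D\<^esub> (ar F f \<star>\<^bsub>S'\<^esub> ar F g) = ar F (f \<star>\<^bsub>S\<^esub> g) \<cdot>\<^bsub>D\<^esub> \<mu> X Y"
    and mult_assoc: "\<lbrakk>X \<in> Obj C; Y \<in> Obj C; Z \<in> Obj C\<rbrakk> \<Longrightarrow>
      ar F (assoc S X Y Z) \<cdot>\<^bsub>D\<^esub> \<mu> (X \<otimes>\<^bsub>S\<^esub> Y) Z \<cdot>\<^bsub>D\<^esub> (\<mu> X Y \<star>\<^bsub>S'\<^esub> Ide D (ob F Z)) =
      \<mu> X (Y \<otimes>\<^bsub>S\<^esub> Z) \<cdot>\<^bsub>D\<^esub> (Ide D (ob F X) \<star>\<^bsub>S'\<^esub> \<mu> Y Z) \<cdot>\<^bsub>D\<^esub> assoc S' (ob F X) (ob F Y) (ob F Z)"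
    and mult_lunit: "X \<in> Obj C \<Longrightarrow>
      ar F (lunit S X) \<cdot>\<^bsub>D\<^esub> \<mu> (unit S) X \<cdot>\<^bsub>D\<^esub> (\<eta> \<star>\<^bsub>S'\<^esub> Ide D (ob F X)) = lunit S' (ob F X)"
    and mult_runit: "X \<in> Obj C \<Longrightarrow>
      ar F (runit S X) \<cdot>\<^bsub>D\<^esub> \<mu> X (unit S) \<cdot>\<^bsub>D\<^esub> (Ide D (ob F X) \<star>\<^bsub>S'\<^esub> \<eta>) = runit S' (ob F X)"

locale monoidal_nat_trans =
  F: lax_monoidal_functor C S D S' F \<mu> \<eta> + G: lax_monoidal_functor C S D S' G \<mu>' \<eta>' +
  nat_trans C D F G \<tau>
  for C S D S' F \<mu> \<eta> G \<mu>' \<eta>' and \<tau> :: "'o \<Rightarrow> 'b" +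
  assumes compat_mult: "\<lbrakk>X \<in> Obj C; Y \<in> Obj C\<rbrakk> \<Longrightarrow>
      \<tau> (X \<otimes>\<^bsub>S\<^esub> Y) \<cdot>\<^bsub>D\<^esub> \<mu> X Y = \<mu>' X Y \<cdot>\<^bsub>D\<^esub> (\<tau> X \<star>\<^bsub>S'\<^esub> \<tau> Y)"
    and compat_unit: "\<tau> (unit S) \<cdot>\<^bsub>D\<^esub> \<eta> = \<eta>'"

locale comonad = endo: is_functor C C Q
  for C :: "('o, 'a) cat" and Q :: "('o, 'a, 'o, 'a) funct" +
  fixes w n :: "'o \<Rightarrow> 'a"
  assumes comult: "nat_trans C C Q (comp_funct Q Q) w"
    and counit: "nat_trans C C Q id_funct n"
    and coassoc: "X \<in> Obj C \<Longrightarrow> ar Q (w X) \<cdot>\<^bsub>C\<^esub> w X = w (ob Q X) \<cdot>\<^bsub>C\<^esub> w X"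
    and counit_left: "X \<in> Obj C \<Longrightarrow> n (ob Q X) \<cdot>\<^bsub>C\<^esub> w X = Ide C (ob Q X)"
    and counit_right: "X \<in> Obj C \<Longrightarrow> ar Q (n X) \<cdot>\<^bsub>C\<^esub> w X = Ide C (ob Q X)"

text \<open>
  In \<open>comult_monoidal\<close> the functor \<open>QQ\<close> carries the composite lax structure
  \<open>QQX \<otimes> QQY \<rightarrow> Q(QX \<otimes> QY) \<rightarrow> QQ(X \<otimes> Y)\<close> and \<open>\<one> \<rightarrow> Q\<one> \<rightarrow> QQ\<one>\<close>.
\<close>

locale hopf_comonad = comonad C Q w n + lax_monoidal_functor C S C S Q \<mu> \<eta>
  for C S Q w n \<mu> \<eta> +
  assumes comult_monoidal: "monoidal_nat_trans C S C S Q \<mu> \<eta>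
      (comp_funct Q Q) (\<lambda>X Y. ar Q (\<mu> X Y) \<cdot>\<^bsub>C\<^esub> \<mu> (ob Q X) (ob Q Y)) (ar Q \<eta> \<cdot>\<^bsub>C\<^esub> \<eta>) w"
    and counit_monoidal: "monoidal_nat_trans C S C S Q \<mu> \<eta>
      id_funct (\<lambda>X Y. Ide C (X \<otimes>\<^bsub>S\<^esub> Y)) (Ide C (unit S)) n"


section \<open>Coalgebras over a comonad\<close>

text \<open>
  A coalgebra is a pair of an object and a coaction.  A morphism carries its source and target
  coalgebra, since the same underlying arrow may be a morphism between different coalgebras.
\<close>

type_synonym ('o, 'a) str = "'o \<times> 'a"
type_synonym ('o, 'a) str_arr = "('o, 'a) str \<times> ('o, 'a) str \<times> 'a"

definition Coalg :: "('o, 'a) cat \<Rightarrow> ('o, 'a, 'o, 'a) funct \<Rightarrow> ('o \<Rightarrow> 'a) \<Rightarrow> ('o \<Rightarrow> 'a) \<Rightarrow>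
    (('o, 'a) str, ('o, 'a) str_arr) cat" where
  "Coalg C Q w n = (let
     obs = {(V, c). V \<in> Obj C \<and> c \<in> hom C V (ob Q V) \<and>
       n V \<cdot>\<^bsub>C\<^esub> c = Ide C V \<and> w V \<cdot>\<^bsub>C\<^esub> c = ar Q c \<cdot>\<^bsub>C\<^esub> c}
   in \<lparr>Obj = obs,
     Arr = {((V, c), (W, d), f). (V, c) \<in> obs \<and> (W, d) \<in> obs \<and>
       f \<in> hom C V W \<and> d \<cdot>\<^bsub>C\<^esub> f = ar Q f \<cdot>\<^bsub>C\<^esub> c},
     Dom = (\<lambda>(A, B, f). A),
     Cod = (\<lambda>(A, B, f). B),
     Ide = (\<lambda>A. (A, A, Ide C (fst A))),
     Comp = (\<lambda>(B, B', g) (A, A', f). (A, B', g \<cdot>\<^bsub>C\<^esub> f))\<rparr>)"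

definition coalg_tensor_ob :: "('o, 'a) cat \<Rightarrow> ('o, 'a) monoidal \<Rightarrow> ('o \<Rightarrow> 'o \<Rightarrow> 'a) \<Rightarrow>
    ('o, 'a) str \<Rightarrow> ('o, 'a) str \<Rightarrow> ('o, 'a) str" where
  "coalg_tensor_ob C S \<mu> A B =
     (fst A \<otimes>\<^bsub>S\<^esub> fst B, \<mu> (fst A) (fst B) \<cdot>\<^bsub>C\<^esub> (snd A \<star>\<^bsub>S\<^esub> snd B))"

definition Coalg_monoidal :: "('o, 'a) cat \<Rightarrow> ('o, 'a) monoidal \<Rightarrow> ('o \<Rightarrow> 'o \<Rightarrow> 'a) \<Rightarrow> 'a \<Rightarrow>
    (('o, 'a) str, ('o, 'a) str_arr) monoidal" where
  "Coalg_monoidal C S \<mu> \<eta> = (let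
     t = coalg_tensor_ob C S \<mu>;
     I = (unit S, \<eta>)
   in \<lparr>tensor = \<lparr>ob = (\<lambda>(A, B). t A B),
       ar = (\<lambda>((A, A', f), (B, B', g)). (t A B, t A' B', f \<star>\<^bsub>S\<^esub> g))\<rparr>,
     unit = I,
     assoc = (\<lambda>A B D. (t (t A B) D, t A (t B D), assoc S (fst A) (fst B) (fst D))),
     lunit = (\<lambda>A. (t I A, A, lunit S (fst A))),
     runit = (\<lambda>A. (t A I, A, runit S (fst A)))\<rparr>)"


section \<open>Algebras over a monad\<close>

locale monad = endo: is_functor D D M
  for D :: "('o, 'a) cat" and M :: "('o, 'a, 'o, 'a) funct" +
  fixes m e :: "'o \<Rightarrow> 'a"
  assumes mult: "nat_trans D D (comp_funct M M) M m"
    and unit: "nat_trans D D id_funct M e"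
    and assoc: "X \<in> Obj D \<Longrightarrow> m X \<cdot>\<^bsub>D\<^esub> ar M (m X) = m X \<cdot>\<^bsub>D\<^esub> m (ob M X)"
    and unit_left: "X \<in> Obj D \<Longrightarrow> m X \<cdot>\<^bsub>D\<^esub> e (ob M X) = Ide D (ob M X)"
    and unit_right: "X \<in> Obj D \<Longrightarrow> m X \<cdot>\<^bsub>D\<^esub> ar M (e X) = Ide D (ob M X)"

definition Alg :: "('o, 'a) cat \<Rightarrow> ('o, 'a, 'o, 'a) funct \<Rightarrow> ('o \<Rightarrow> 'a) \<Rightarrow> ('o \<Rightarrow> 'a) \<Rightarrow>
    (('o, 'a) str, ('o, 'a) str_arr) cat" where
  "Alg D M m e = (let
     obs = {(X, a). X \<in> Obj D \<and> a \<in> hom D (ob M X) X \<and>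
       a \<cdot>\<^bsub>D\<^esub> e X = Ide D X \<and> a \<cdot>\<^bsub>D\<^esub> m X = a \<cdot>\<^bsub>D\<^esub> ar M a}
   in \<lparr>Obj = obs,
     Arr = {((X, a), (Y, b), f). (X, a) \<in> obs \<and> (Y, b) \<in> obs \<and>
       f \<in> hom D X Y \<and> f \<cdot>\<^bsub>D\<^esub> a = b \<cdot>\<^bsub>D\<^esub> ar M f},
     Dom = (\<lambda>(A, B, f). A),
     Cod = (\<lambda>(A, B, f). B),
     Ide = (\<lambda>A. (A, A, Ide D (fst A))),
     Comp = (\<lambda>(B, B', g) (A, A', f). (A, B', g \<cdot>\<^bsub>D\<^esub> f))\<rparr>)"

text \<open>Algebras and coalgebras share their representation, hence the forgetful functor.\<close>

definition forget :: "(('o, 'a) str, ('o, 'a) str_arr, 'o, 'a) funct" where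
  "forget = \<lparr>ob = fst, ar = (\<lambda>(A, B, f). f)\<rparr>"


section \<open>Tensorisations, cotensorisations, enrichments\<close>

record ('eo, 'ea, 'o, 'a) tensoring =
  act :: "('eo \<times> 'o, 'ea \<times> 'a, 'o, 'a) funct"
  act_unit :: "'o \<Rightarrow> 'a"
  act_assoc :: "'eo \<Rightarrow> 'eo \<Rightarrow> 'o \<Rightarrow> 'a"

locale tensorisation = base: monoidal_category E S + category D
  for E :: "('eo, 'ea) cat" and S :: "('eo, 'ea) monoidal" and D :: "('o, 'a) cat" +
  fixes T :: "('eo, 'ea, 'o, 'a) tensoring"
  assumes act_functor: "is_functor (prod_cat E D) D (act T)"
    and act_unit_hom: "X \<in> Obj D \<Longrightarrow> act_unit T X \<in> hom D (ob (act T) (unit S, X)) X"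
    and act_unit_natural: "f \<in> hom D X X' \<Longrightarrow>
      act_unit T X' \<cdot>\<^bsub>D\<^esub> ar (act T) (Ide E (unit S), f) = f \<cdot>\<^bsub>D\<^esub> act_unit T X"
    and act_assoc_hom: "\<lbrakk>V' \<in> Obj E; V \<in> Obj E; X \<in> Obj D\<rbrakk> \<Longrightarrow>
      act_assoc T V' V X \<in>
        hom D (ob (act T) (V' \<otimes>\<^bsub>S\<^esub> V, X)) (ob (act T) (V', ob (act T) (V, X)))"
    and act_assoc_natural: "\<lbrakk>v' \<in> hom E V' W'; v \<in> hom E V W; f \<in> hom D X Y\<rbrakk> \<Longrightarrow>
      act_assoc T W' W Y \<cdot>\<^bsub>D\<^esub> ar (act T) (v' \<star>\<^bsub>S\<^esub> v, f) =
      ar (act T) (v', ar (act T) (v, f)) \<cdot>\<^bsub>D\<^esub> act_assoc T V' V X"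
    and act_pentagon: "\<lbrakk>V'' \<in> Obj E; V' \<in> Obj E; V \<in> Obj E; X \<in> Obj D\<rbrakk> \<Longrightarrow>
      act_assoc T V'' V' (ob (act T) (V, X)) \<cdot>\<^bsub>D\<^esub> act_assoc T (V'' \<otimes>\<^bsub>S\<^esub> V') V X =
      ar (act T) (Ide E V'', act_assoc T V' V X) \<cdot>\<^bsub>D\<^esub> act_assoc T V'' (V' \<otimes>\<^bsub>S\<^esub> V) X \<cdot>\<^bsub>D\<^esub>
        ar (act T) (assoc S V'' V' V, Ide D X)"
    and act_lunit: "\<lbrakk>V \<in> Obj E; X \<in> Obj D\<rbrakk> \<Longrightarrow>
      act_unit T (ob (act T) (V, X)) \<cdot>\<^bsub>D\<^esub> act_assoc T (unit S) V X =
      ar (act T) (lunit S V, Ide D X)"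
    and act_runit: "\<lbrakk>V \<in> Obj E; X \<in> Obj D\<rbrakk> \<Longrightarrow>
      ar (act T) (Ide E V, act_unit T X) \<cdot>\<^bsub>D\<^esub> act_assoc T V (unit S) X =
      ar (act T) (runit S V, Ide D X)"

text \<open>
  Conventions: the bifunctor \<open>\<langle>X, V\<rangle>\<close>, the maps
  \<open>cot_unit X : X \<rightarrow> \<langle>X, \<one>\<rangle>\<close> and \<open>cot_assoc X V V' : \<langle>\<langle>X, V\<rangle>, V'\<rangle> \<rightarrow> \<langle>X, V \<otimes> V'\<rangle>\<close>.
\<close>

record ('eo, 'ea, 'o, 'a) cotensoring =
  cot :: "('o \<times> 'eo, 'a \<times> 'ea, 'o, 'a) funct"
  cot_unit :: "'o \<Rightarrow> 'a"
  cot_assoc :: "'o \<Rightarrow> 'eo \<Rightarrow> 'eo \<Rightarrow> 'a"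

definition op_tensoring ::
  "('eo, 'ea, 'o, 'a) cotensoring \<Rightarrow> ('eo, 'ea, 'o, 'a) tensoring" where
  "op_tensoring K = \<lparr>
     act = \<lparr>ob = (\<lambda>(V, X). ob (cot K) (X, V)), ar = (\<lambda>(v, f). ar (cot K) (f, v))\<rparr>,
     act_unit = cot_unit K,
     act_assoc = (\<lambda>V' V X. cot_assoc K X V V')\<rparr>"

definition cotensorisation :: "('eo, 'ea) cat \<Rightarrow> ('eo, 'ea) monoidal \<Rightarrow> ('o, 'a) cat \<Rightarrow>
    ('eo, 'ea, 'o, 'a) cotensoring \<Rightarrow> bool" where
  "cotensorisation E S D K \<longleftrightarrow>
     is_functor (prod_cat D (op_cat E)) D (cot K) \<and>
     tensorisation E (transposed E S) (op_cat D) (op_tensoring K)"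

text \<open>
  The coherence structure sits on the cotensorisation only; \<open>\<phi> V X Y : hom(V \<boxtimes> X, Y) \<simeq> hom(V, {X, Y})\<close>
  and \<open>\<psi> V X Y : hom(V, {X, Y}) \<simeq> hom(X, \<langle>Y, V\<rangle>)\<close> transport it to \<open>\<boxtimes>\<close> and \<open>{-, -}\<close>.
\<close>

locale enriched_tensored_cotensored =
  base: monoidal_category E S + category D
  for E :: "('eo, 'ea) cat" and S :: "('eo, 'ea) monoidal" and D :: "('o, 'a) cat" +
  fixes T :: "('eo \<times> 'o, 'ea \<times> 'a, 'o, 'a) funct"
    and H :: "('o \<times> 'o, 'a \<times> 'a, 'eo, 'ea) funct"
    and K :: "('eo, 'ea, 'o, 'a) cotensoring"
    and \<phi> :: "'eo \<Rightarrow> 'o \<Rightarrow> 'o \<Rightarrow> 'a \<Rightarrow> 'ea"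
    and \<psi> :: "'eo \<Rightarrow> 'o \<Rightarrow> 'o \<Rightarrow> 'ea \<Rightarrow> 'a"
  assumes tensor_bifunctor: "is_functor (prod_cat E D) D T"
    and hom_bifunctor: "is_functor (prod_cat (op_cat D) D) E H"
    and cotensor: "cotensorisation E S D K"
    and tensor_hom_bij: "\<lbrakk>V \<in> Obj E; X \<in> Obj D; Y \<in> Obj D\<rbrakk> \<Longrightarrow>
      bij_betw (\<phi> V X Y) (hom D (ob T (V, X)) Y) (hom E V (ob H (X, Y)))"
    and hom_cotensor_bij: "\<lbrakk>V \<in> Obj E; X \<in> Obj D; Y \<in> Obj D\<rbrakk> \<Longrightarrow>
      bij_betw (\<psi> V X Y) (hom E V (ob H (X, Y))) (hom D X (ob (cot K) (Y, V)))"
    and tensor_hom_natural: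
      "\<lbrakk>v \<in> hom E V' V; x \<in> hom D X' X; y \<in> hom D Y Y'; f \<in> hom D (ob T (V, X)) Y\<rbrakk> \<Longrightarrow>
      \<phi> V' X' Y' (y \<cdot>\<^bsub>D\<^esub> f \<cdot>\<^bsub>D\<^esub> ar T (v, x)) = ar H (x, y) \<cdot>\<^bsub>E\<^esub> \<phi> V X Y f \<cdot>\<^bsub>E\<^esub> v"
    and hom_cotensor_natural:
      "\<lbrakk>v \<in> hom E V' V; x \<in> hom D X' X; y \<in> hom D Y Y'; h \<in> hom E V (ob H (X, Y))\<rbrakk> \<Longrightarrow>
      \<psi> V' X' Y' (ar H (x, y) \<cdot>\<^bsub>E\<^esub> h \<cdot>\<^bsub>E\<^esub> v) = ar (cot K) (y, v) \<cdot>\<^bsub>D\<^esub> \<psi> V X Y h \<cdot>\<^bsub>D\<^esub> x"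

text \<open>
  The cotensorisation \<open>K'\<close> of \<open>D'\<close> by \<open>E'\<close> strictly lifts the cotensorisation \<open>K\<close> along
  the functors \<open>U\<close> (out of \<open>D'\<close>) and \<open>P\<close> (out of \<open>E'\<close>).
\<close>

definition lifts_cotensorisation ::
  "('fo, 'fa) cat \<Rightarrow> ('p, 'b) cat \<Rightarrow> ('fo, 'fa, 'eo, 'ea) funct \<Rightarrow> ('p, 'b, 'o, 'a) funct \<Rightarrow>
   ('fo, 'fa, 'p, 'b) cotensoring \<Rightarrow> ('eo, 'ea, 'o, 'a) cotensoring \<Rightarrow> bool" where
  "lifts_cotensorisation E' D' P U K' K \<longleftrightarrow>
     (\<forall>X \<in> Obj D'. \<forall>V \<in> Obj E'. ob U (ob (cot K') (X, V)) = ob (cot K) (ob U X, ob P V)) \<and>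
     (\<forall>f \<in> Arr D'. \<forall>v \<in> Arr E'. ar U (ar (cot K') (f, v)) = ar (cot K) (ar U f, ar P v)) \<and>
     (\<forall>X \<in> Obj D'. ar U (cot_unit K' X) = cot_unit K (ob U X)) \<and>
     (\<forall>X \<in> Obj D'. \<forall>V \<in> Obj E'. \<forall>V' \<in> Obj E'.
        ar U (cot_assoc K' X V V') = cot_assoc K (ob U X) (ob P V) (ob P V'))"

end

theory Submission
  imports Defs
begin

text \<open>
  Through the bijections \<open>hom(V \<boxtimes> X, Y) \<simeq> hom(V, {X, Y}) \<simeq> hom(X, \<langle>Y, V\<rangle>)\<close>, tensors and mapping objects
  over a given cotensorisation are determined by universal properties: \<open>V \<boxtimes> -\<close> is left adjoint to
  \<open>\<langle>-, V\<rangle>\<close>, and \<open>{-, Y}\<close>, with values in the opposite category, is left adjoint to \<open>\<langle>Y, -\<rangle>\<close>.  Conversely,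
  pointwise left adjoints of these functors are automatically functorial and natural in all
  variables (\<open>enriched_tensored_cotensored_if_universal\<close>).  So the theorem asks for left adjoints of
  two families of functors with values in \<open>M\<close>-algebras.

  Both are instances of Dubuc's adjoint triangle theorem (\<open>adjoint_triangle\<close>).  Let \<open>G\<close> be a functor
  from a category with reflexive coequalisers to \<open>M\<close>-algebras whose composite with the forgetful
  functor has a left adjoint.  This left adjoint represents \<open>hom(MX, G -)\<close> for every free algebra
  \<open>MX\<close>.  An arbitrary algebra is the coequaliser of a reflexive pair between free algebras, and
  the coequaliser of the corresponding pair of representing objects represents \<open>hom(X, G -)\<close>.

  Because the cotensorisation is lifted strictly, the composite of \<open>\<langle>-, V\<rangle>\<close> with the forgetful functor
  is \<open>\<langle>-, V\<rangle>\<close> on \<open>D\<close> after the forgetful functor, and similarly for \<open>\<langle>Y, -\<rangle>\<close>.  Left adjoints exist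
  there: on \<open>D\<close> by hypothesis, for the forgetful functors by free algebras and cofree coalgebras.
  It remains to have reflexive coequalisers in the source categories.  For algebras they are lifted
  from \<open>D\<close>, since \<open>M\<close> preserves them (\<open>Alg_has_reflexive_coequalisers\<close>).  For the opposite of
  \<open>Q\<close>-coalgebras the statement is the same one, applied to \<open>Q\<close> as a monad on the opposite of \<open>C\<close>
  (\<open>op_Coalg\<close>).  The Hopf structure makes coalgebras a monoidal category
  (\<open>Coalg_monoidal_category\<close>).
\<close>

section \<open>Categories, opposites and products\<close>

context category
begin

lemma ide_arr [simp]: "X \<in> Obj C \<Longrightarrow> Ide C X \<in> Arr C"
  and dom_ide [simp]: "X \<in> Obj C \<Longrightarrow> Dom C (Ide C X) = X"
  and cod_ide [simp]: "X \<in> Obj C \<Longrightarrow> Cod C (Ide C X) = X"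
  using id_hom by (auto simp: hom_def)

lemma comp_arr [simp]: "\<lbrakk>f \<in> Arr C; g \<in> Arr C; Dom C g = Cod C f\<rbrakk> \<Longrightarrow> g \<cdot> f \<in> Arr C"
  and dom_comp [simp]: "\<lbrakk>f \<in> Arr C; g \<in> Arr C; Dom C g = Cod C f\<rbrakk> \<Longrightarrow> Dom C (g \<cdot> f) = Dom C f"
  and cod_comp [simp]: "\<lbrakk>f \<in> Arr C; g \<in> Arr C; Dom C g = Cod C f\<rbrakk> \<Longrightarrow> Cod C (g \<cdot> f) = Cod C g"
  using comp_hom[of f "Dom C f" "Cod C f" g "Cod C g"] by (auto simp: hom_def)

lemma comp_ide [simp]: "\<lbrakk>f \<in> Arr C; Dom C f = X\<rbrakk> \<Longrightarrow> f \<cdot> Ide C X = f"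
  using comp_id_right[of f "Dom C f" "Cod C f"] by (auto simp: hom_def)

lemma ide_comp [simp]: "\<lbrakk>f \<in> Arr C; Cod C f = X\<rbrakk> \<Longrightarrow> Ide C X \<cdot> f = f"
  using comp_id_left[of f "Dom C f" "Cod C f"] by (auto simp: hom_def)

lemma assoc_arr [simp]:
  "\<lbrakk>f \<in> Arr C; g \<in> Arr C; h \<in> Arr C; Dom C g = Cod C f; Dom C h = Cod C g\<rbrakk> \<Longrightarrow>
    (h \<cdot> g) \<cdot> f = h \<cdot> (g \<cdot> f)"
  using comp_assoc[of f "Dom C f" "Cod C f" g "Cod C g" h "Cod C h"] by (auto simp: hom_def)

text \<open>
  Composites are kept associated to the right; this is how a relation between two-fold composites
  is used inside a longer one.
\<close>

lemma comp_cong_tail: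
  assumes "g \<cdot> f = k" "f \<in> Arr C" "g \<in> Arr C" "r \<in> Arr C" "Dom C g = Cod C f" "Dom C f = Cod C r"
  shows "g \<cdot> (f \<cdot> r) = k \<cdot> r"
  using assms assoc_arr[of r f g] by simp

lemma hom_obj: "f \<in> hom C X Y \<Longrightarrow> X \<in> Obj C \<and> Y \<in> Obj C"
  using dom_obj cod_obj by (auto simp: hom_def)

end

lemma op_simps [simp]:
  "Obj (op_cat C) = Obj C" "Arr (op_cat C) = Arr C" "Dom (op_cat C) = Cod C"
  "Cod (op_cat C) = Dom C" "Ide (op_cat C) = Ide C" "g \<cdot>\<^bsub>op_cat C\<^esub> f = f \<cdot>\<^bsub>C\<^esub> g"
  by (simp_all add: op_cat_def)

lemma hom_op [simp]: "hom (op_cat C) X Y = hom C Y X"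
  by (auto simp: hom_def)

lemma op_op [simp]: "op_cat (op_cat C) = C"
  by (simp add: op_cat_def)

lemma prod_simps [simp]:
  "Obj (prod_cat C D) = Obj C \<times> Obj D" "Arr (prod_cat C D) = Arr C \<times> Arr D"
  "Dom (prod_cat C D) (f, g) = (Dom C f, Dom D g)" "Cod (prod_cat C D) (f, g) = (Cod C f, Cod D g)"
  "Ide (prod_cat C D) (X, Y) = (Ide C X, Ide D Y)"
  "(f', g') \<cdot>\<^bsub>prod_cat C D\<^esub> (f, g) = (f' \<cdot>\<^bsub>C\<^esub> f, g' \<cdot>\<^bsub>D\<^esub> g)"
  by (simp_all add: prod_cat_def)

lemma hom_prod [simp]: "hom (prod_cat C D) (X, Y) (X', Y') = hom C X X' \<times> hom D Y Y'"
  by (auto simp: hom_def)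

lemma category_op: "category C \<Longrightarrow> category (op_cat C)"
  unfolding category_def by (simp, simp add: hom_def)

lemma category_prod:
  assumes "category C" "category D" shows "category (prod_cat C D)"
proof -
  interpret C: category C by fact
  interpret D: category D by fact
  show ?thesis
    by unfold_locales
      (auto simp: hom_def C.dom_obj C.cod_obj D.dom_obj D.cod_obj)
qed

lemma op_prod: "op_cat (prod_cat C D) = prod_cat (op_cat C) (op_cat D)"
  by (simp add: op_cat_def prod_cat_def fun_eq_iff)

section \<open>Functors\<close>

context is_functor
begin

lemma ar_arr [simp]: "f \<in> Arr C \<Longrightarrow> ar F f \<in> Arr D"
  and dom_ar [simp]: "f \<in> Arr C \<Longrightarrow> Dom D (ar F f) = ob F (Dom C f)"
  and cod_ar [simp]: "f \<in> Arr C \<Longrightarrow> Cod D (ar F f) = ob F (Cod C f)"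
  using ar_hom[of f "Dom C f" "Cod C f"] by (auto simp: hom_def)

lemma ar_comp_arr: "\<lbrakk>f \<in> Arr C; g \<in> Arr C; Dom C g = Cod C f\<rbrakk> \<Longrightarrow>
    ar F (g \<cdot>\<^bsub>C\<^esub> f) = ar F g \<cdot>\<^bsub>D\<^esub> ar F f"
  using ar_comp[of f "Dom C f" "Cod C f" g "Cod C g"] by (auto simp: hom_def)

declare ob_obj [simp] ar_id [simp]

lemma functor_op: "is_functor (op_cat C) (op_cat D) F"
proof -
  interpret C: category "op_cat C" by (rule category_op) unfold_locales
  interpret D: category "op_cat D" by (rule category_op) unfold_locales
  show ?thesis
    by unfold_locales (auto simp: ar_hom intro: ar_comp)
qed

end

lemma functor_comp:
  assumes "is_functor A B F" "is_functor B C G" shows "is_functor A C (comp_funct G F)"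
proof -
  interpret F: is_functor A B F by fact
  interpret G: is_functor B C G by fact
  show ?thesis
    by unfold_locales
      (auto simp: comp_funct_def intro: F.ar_hom G.ar_hom, auto simp: hom_def F.ar_comp_arr G.ar_comp_arr)
qed

definition swap_args :: "('o \<times> 'p, 'a \<times> 'b, 'q, 'c) funct \<Rightarrow> ('p \<times> 'o, 'b \<times> 'a, 'q, 'c) funct" where
  "swap_args F = \<lparr>ob = (\<lambda>(Y, X). ob F (X, Y)), ar = (\<lambda>(g, f). ar F (f, g))\<rparr>"

lemma swap_args_simps [simp]:
  "ob (swap_args F) (Y, X) = ob F (X, Y)" "ar (swap_args F) (g, f) = ar F (f, g)"
  by (simp_all add: swap_args_def)

text \<open>
  The locale of two-variable functors names both factors, so that pairs of arrows can be composed
  componentwise.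
\<close>

locale bifunctor = P: category P + A: category A + is_functor "prod_cat P A" B G
  for P :: "('po, 'pa) cat" and A :: "('o, 'a) cat" and B :: "('q, 'b) cat" and G
begin

lemma bi_obj [simp]: "\<lbrakk>p \<in> Obj P; X \<in> Obj A\<rbrakk> \<Longrightarrow> ob G (p, X) \<in> Obj B"
  by (simp add: ob_obj)

lemma bi_arr [simp]: "\<lbrakk>v \<in> Arr P; f \<in> Arr A\<rbrakk> \<Longrightarrow> ar G (v, f) \<in> Arr B"
  and bi_dom [simp]: "\<lbrakk>v \<in> Arr P; f \<in> Arr A\<rbrakk> \<Longrightarrow> Dom B (ar G (v, f)) = ob G (Dom P v, Dom A f)"
  and bi_cod [simp]: "\<lbrakk>v \<in> Arr P; f \<in> Arr A\<rbrakk> \<Longrightarrow> Cod B (ar G (v, f)) = ob G (Cod P v, Cod A f)"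
  by simp_all

lemma bi_id [simp]: "\<lbrakk>p \<in> Obj P; X \<in> Obj A\<rbrakk> \<Longrightarrow> ar G (Ide P p, Ide A X) = Ide B (ob G (p, X))"
  using ar_id[of "(p, X)"] by simp

lemma bi_comp:
  "\<lbrakk>v \<in> Arr P; v' \<in> Arr P; Dom P v' = Cod P v; f \<in> Arr A; f' \<in> Arr A; Dom A f' = Cod A f\<rbrakk> \<Longrightarrow>
    ar G (v', f') \<cdot>\<^bsub>B\<^esub> ar G (v, f) = ar G (v' \<cdot>\<^bsub>P\<^esub> v, f' \<cdot>\<^bsub>A\<^esub> f)"
  using ar_comp_arr[of "(v, f)" "(v', f')"] by simp

lemma bi_comp_tail:
  "\<lbrakk>v \<in> Arr P; v' \<in> Arr P; Dom P v' = Cod P v; f \<in> Arr A; f' \<in> Arr A; Dom A f' = Cod A f;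
    r \<in> Arr B; Cod B r = ob G (Dom P v, Dom A f)\<rbrakk> \<Longrightarrow>
    ar G (v', f') \<cdot>\<^bsub>B\<^esub> (ar G (v, f) \<cdot>\<^bsub>B\<^esub> r) = ar G (v' \<cdot>\<^bsub>P\<^esub> v, f' \<cdot>\<^bsub>A\<^esub> f) \<cdot>\<^bsub>B\<^esub> r"
  by (rule target.comp_cong_tail[OF bi_comp]) simp_all

lemma functor_swap: "is_functor (prod_cat A P) B (swap_args G)"
proof -
  interpret AP: category "prod_cat A P" by (rule category_prod) unfold_locales
  show ?thesis
    by unfold_locales (auto simp: hom_def bi_comp)
qed

end

text \<open>The functor \<open>G(p, -)\<close> of the second variable.\<close>

definition slice :: "('po, 'pa) cat \<Rightarrow> ('po \<times> 'o, 'pa \<times> 'a, 'q, 'b) funct \<Rightarrow> 'po \<Rightarrow>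
    ('o, 'a, 'q, 'b) funct" where
  "slice P G p = \<lparr>ob = (\<lambda>X. ob G (p, X)), ar = (\<lambda>f. ar G (Ide P p, f))\<rparr>"

lemma slice_simps [simp]:
  "ob (slice P G p) X = ob G (p, X)" "ar (slice P G p) f = ar G (Ide P p, f)"
  by (simp_all add: slice_def)

lemma (in bifunctor) functor_slice: "p \<in> Obj P \<Longrightarrow> is_functor A B (slice P G p)"
  by unfold_locales (auto simp: hom_def bi_comp)

section \<open>Universal arrows\<close>

definition universal_arrow ::
  "('o, 'a) cat \<Rightarrow> ('p, 'b) cat \<Rightarrow> ('o, 'a, 'p, 'b) funct \<Rightarrow> 'p \<Rightarrow> 'o \<Rightarrow> 'b \<Rightarrow> bool" where
  "universal_arrow A B G X L u \<longleftrightarrow> L \<in> Obj A \<and> u \<in> hom B X (ob G L) \<and>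
     (\<forall>Y \<in> Obj A. \<forall>f \<in> hom B X (ob G Y). \<exists>!g. g \<in> hom A L Y \<and> ar G g \<cdot>\<^bsub>B\<^esub> u = f)"

definition has_universal_arrows ::
  "('o, 'a) cat \<Rightarrow> ('p, 'b) cat \<Rightarrow> ('o, 'a, 'p, 'b) funct \<Rightarrow> bool" where
  "has_universal_arrows A B G \<longleftrightarrow> (\<forall>X \<in> Obj B. \<exists>L u. universal_arrow A B G X L u)"

lemma universal_arrowI:
  assumes "L \<in> Obj A" "u \<in> hom B X (ob G L)"
    and "\<And>Y f. \<lbrakk>Y \<in> Obj A; f \<in> hom B X (ob G Y)\<rbrakk> \<Longrightarrow> \<exists>!g. g \<in> hom A L Y \<and> ar G g \<cdot>\<^bsub>B\<^esub> u = f"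
  shows "universal_arrow A B G X L u"
  unfolding universal_arrow_def by (intro conjI ballI assms)

lemma universal_arrowD:
  assumes "universal_arrow A B G X L u"
  shows "L \<in> Obj A" "u \<in> hom B X (ob G L)"
  using assms by (auto simp: universal_arrow_def)

lemma universal_arrow_ex1:
  assumes "universal_arrow A B G X L u" "f \<in> hom B X (ob G Y)" "Y \<in> Obj A"
  shows "\<exists>!g. g \<in> hom A L Y \<and> ar G g \<cdot>\<^bsub>B\<^esub> u = f"
  using assms unfolding universal_arrow_def by blast

lemma universal_arrow_eqI:
  assumes "universal_arrow A B G X L u" "is_functor A B G"
    and "g \<in> hom A L Y" "g' \<in> hom A L Y" "ar G g \<cdot>\<^bsub>B\<^esub> u = ar G g' \<cdot>\<^bsub>B\<^esub> u"
  shows "g = g'"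
proof -
  interpret is_functor A B G by fact
  have "Y \<in> Obj A" using source.hom_obj assms(3) by blast
  moreover have "ar G g \<cdot>\<^bsub>B\<^esub> u \<in> hom B X (ob G Y)"
    using universal_arrowD(2)[OF assms(1)] assms(3) by (auto intro: target.comp_hom ar_hom)
  ultimately show ?thesis using assms unfolding universal_arrow_def by metis
qed

text \<open>
  A functor is a record of total functions, so two presentations of the same functor may differ
  away from the objects and arrows of the source; the universal property does not see this.
\<close>

lemma has_universal_arrows_cong:
  assumes "has_universal_arrows A B G"
    and "\<And>X. X \<in> Obj A \<Longrightarrow> ob G' X = ob G X" "\<And>f. f \<in> Arr A \<Longrightarrow> ar G' f = ar G f"
  shows "has_universal_arrows A B G'"
proof -
  have "universal_arrow A B G' X L u" if "universal_arrow A B G X L u" for X L u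
  proof -
    have "\<exists>!g. g \<in> hom A L Y \<and> ar G' g \<cdot>\<^bsub>B\<^esub> u = f" if "Y \<in> Obj A" "f \<in> hom B X (ob G' Y)" for Y f
    proof -
      have "\<exists>!g. g \<in> hom A L Y \<and> ar G g \<cdot>\<^bsub>B\<^esub> u = f"
        using \<open>universal_arrow A B G X L u\<close> that assms(2) by (simp add: universal_arrow_def)
      moreover have "g \<in> hom A L Y \<and> ar G g \<cdot>\<^bsub>B\<^esub> u = f \<longleftrightarrow> g \<in> hom A L Y \<and> ar G' g \<cdot>\<^bsub>B\<^esub> u = f" for g
        using assms(3) by (auto simp: hom_def)
      ultimately show ?thesis by simp
    qed
    with that assms(2) show ?thesis by (simp add: universal_arrow_def)
  qed
  with assms(1) show ?thesis unfolding has_universal_arrows_def by blast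
qed

text \<open>
  Left adjoints compose: the universal arrow for \<open>G F\<close> at \<open>X\<close> is the one for \<open>G\<close> at \<open>X\<close> followed by
  the image under \<open>G\<close> of the one for \<open>F\<close> at the resulting object.
\<close>

lemma has_universal_arrows_comp:
  assumes "is_functor A B F" "is_functor B C G"
    and "has_universal_arrows A B F" "has_universal_arrows B C G"
  shows "has_universal_arrows A C (comp_funct G F)"
  unfolding has_universal_arrows_def
proof
  interpret F: is_functor A B F by fact
  interpret G: is_functor B C G by fact
  fix X assume "X \<in> Obj C"
  then obtain L u where u: "universal_arrow B C G X L u"
    using assms(4) by (auto simp: has_universal_arrows_def)
  then obtain L' u' where u': "universal_arrow A B F L L' u'"
    using assms(3) universal_arrowD(1)[OF u] by (auto simp: has_universal_arrows_def)
  note h = universal_arrowD[OF u] universal_arrowD[OF u']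
  have "\<exists>!g. g \<in> hom A L' Y \<and> ar (comp_funct G F) g \<cdot>\<^bsub>C\<^esub> (ar G u' \<cdot>\<^bsub>C\<^esub> u) = f"
    if Y: "Y \<in> Obj A" and f: "f \<in> hom C X (ob (comp_funct G F) Y)" for Y f
  proof -
    have eq: "ar (comp_funct G F) g \<cdot>\<^bsub>C\<^esub> (ar G u' \<cdot>\<^bsub>C\<^esub> u) = ar G (ar F g \<cdot>\<^bsub>B\<^esub> u') \<cdot>\<^bsub>C\<^esub> u"
      if "g \<in> hom A L' Y" for g
      using that h by (simp add: comp_funct_def hom_def G.ar_comp_arr)
    have 1: "\<exists>!k. k \<in> hom B L (ob F Y) \<and> ar G k \<cdot>\<^bsub>C\<^esub> u = f"
      using universal_arrow_ex1[OF u, of f "ob F Y"] Y f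
      by (simp add: comp_funct_def)
    then obtain k where k: "k \<in> hom B L (ob F Y)" "ar G k \<cdot>\<^bsub>C\<^esub> u = f" by blast
    obtain g where g: "g \<in> hom A L' Y" "ar F g \<cdot>\<^bsub>B\<^esub> u' = k"
      using universal_arrow_ex1[OF u' k(1) Y] by blast
    show ?thesis
    proof (rule ex1I[of _ g])
      show "g \<in> hom A L' Y \<and> ar (comp_funct G F) g \<cdot>\<^bsub>C\<^esub> (ar G u' \<cdot>\<^bsub>C\<^esub> u) = f"
        using eq g k by simp
    next
      fix g' assume g': "g' \<in> hom A L' Y \<and> ar (comp_funct G F) g' \<cdot>\<^bsub>C\<^esub> (ar G u' \<cdot>\<^bsub>C\<^esub> u) = f"
      then have "ar F g' \<cdot>\<^bsub>B\<^esub> u' \<in> hom B L (ob F Y)"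
        using h(4) by (auto intro: F.ar_hom F.target.comp_hom)
      then have "ar F g' \<cdot>\<^bsub>B\<^esub> u' = k" using 1 k g' eq by metis
      with g g' show "g' = g" using universal_arrow_eqI[OF u' assms(1)] by metis
    qed
  qed
  moreover have "ar G u' \<cdot>\<^bsub>C\<^esub> u \<in> hom C X (ob (comp_funct G F) L')"
    using h by (auto simp: comp_funct_def intro: G.ar_hom G.target.comp_hom)
  ultimately show "\<exists>L u. universal_arrow A C (comp_funct G F) X L u"
    using h unfolding universal_arrow_def by blast
qed

section \<open>Adjunctions with a parameter\<close>

text \<open>
  Pointwise left adjoints \<open>L(p, -)\<close> of the functors \<open>G(p, -)\<close> assemble to a functor of two variables.
  An arrow \<open>p \<rightarrow> p'\<close> induces \<open>G(p, -) \<rightarrow> G(p', -)\<close> and hence, by transposition, an arrow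
  \<open>L(p', X) \<rightarrow> L(p, X)\<close>; this is why \<open>L\<close> is contravariant in the parameter.  The bijections
  \<open>t p X Y\<close> are transposition along the chosen universal arrows.
\<close>

lemma (in bifunctor) parametrised_adjunction:
  assumes univ: "\<And>p. p \<in> Obj P \<Longrightarrow> has_universal_arrows A B (slice P G p)"
  obtains L t where "is_functor (prod_cat (op_cat P) B) A L"
    and "\<And>p X Y. \<lbrakk>p \<in> Obj P; X \<in> Obj B; Y \<in> Obj A\<rbrakk> \<Longrightarrow>
      bij_betw (t p X Y) (hom A (ob L (p, X)) Y) (hom B X (ob G (p, Y)))"
    and "\<And>p p' v X X' x Y Y' y f. \<lbrakk>v \<in> hom P p p'; x \<in> hom B X' X; y \<in> hom A Y Y';
        f \<in> hom A (ob L (p, X)) Y\<rbrakk> \<Longrightarrow>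
      t p' X' Y' (y \<cdot>\<^bsub>A\<^esub> f \<cdot>\<^bsub>A\<^esub> ar L (v, x)) = ar G (v, y) \<cdot>\<^bsub>B\<^esub> t p X Y f \<cdot>\<^bsub>B\<^esub> x"
proof -
  have "\<exists>Lu. universal_arrow A B (slice P G p) X (fst Lu) (snd Lu)"
    if "p \<in> Obj P" "X \<in> Obj B" for p X
    using univ that by (fastforce simp: has_universal_arrows_def)
  then obtain Lu where Lu: "\<And>p X. p \<in> Obj P \<Longrightarrow> X \<in> Obj B \<Longrightarrow>
      universal_arrow A B (slice P G p) X (fst (Lu p X)) (snd (Lu p X))"
    by metis
  define l where "l p X = fst (Lu p X)" for p X
  define u where "u p X = snd (Lu p X)" for p X
  have U: "universal_arrow A B (slice P G p) X (l p X) (u p X)" if "p \<in> Obj P" "X \<in> Obj B" for p X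
    using Lu[OF that] by (simp add: l_def u_def)
  have l_obj [simp]: "l p X \<in> Obj A" if "p \<in> Obj P" "X \<in> Obj B" for p X
    using universal_arrowD(1)[OF U[OF that]] .
  have u_hom [simp]: "u p X \<in> Arr B" "Dom B (u p X) = X" "Cod B (u p X) = ob G (p, l p X)"
    if "p \<in> Obj P" "X \<in> Obj B" for p X
    using universal_arrowD(2)[OF U[OF that]] by (auto simp: hom_def)
  \<comment> \<open>Functoriality of \<open>L\<close> is forced by extranaturality of the universal arrows in the parameter.\<close>
  define lifts where "lifts v x g \<longleftrightarrow> g \<in> hom A (l (Cod P v) (Dom B x)) (l (Dom P v) (Cod B x)) \<and>
      ar G (Ide P (Cod P v), g) \<cdot>\<^bsub>B\<^esub> u (Cod P v) (Dom B x) =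
      ar G (v, Ide A (l (Dom P v) (Cod B x))) \<cdot>\<^bsub>B\<^esub> (u (Dom P v) (Cod B x) \<cdot>\<^bsub>B\<^esub> x)" for v x g
  define L where "L = \<lparr>ob = (\<lambda>(p, X). l p X), ar = (\<lambda>(v, x). THE g. lifts v x g)\<rparr>"
  have ex1: "\<exists>!g. lifts v x g" if "v \<in> Arr P" "x \<in> Arr B" for v x
    unfolding lifts_def
    using universal_arrow_ex1[OF U[of "Cod P v" "Dom B x"], of
        "ar G (v, Ide A (l (Dom P v) (Cod B x))) \<cdot>\<^bsub>B\<^esub> (u (Dom P v) (Cod B x) \<cdot>\<^bsub>B\<^esub> x)"
        "l (Dom P v) (Cod B x)"]
    using that by (simp add: P.cod_obj P.dom_obj target.cod_obj target.dom_obj hom_def)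
  have L_lifts: "lifts v x (ar L (v, x))" if "v \<in> Arr P" "x \<in> Arr B" for v x
    using theI'[OF ex1[OF that]] by (simp add: L_def)
  have L_eq: "ar L (v, x) = g" if "lifts v x g" "v \<in> Arr P" "x \<in> Arr B" for v x g
    using ex1[OF that(2,3)] L_lifts[OF that(2,3)] that(1) by blast
  have L_arr [simp]: "ar L (v, x) \<in> Arr A" "Dom A (ar L (v, x)) = l (Cod P v) (Dom B x)"
    "Cod A (ar L (v, x)) = l (Dom P v) (Cod B x)" if "v \<in> Arr P" "x \<in> Arr B" for v x
    using L_lifts[OF that] by (auto simp: lifts_def hom_def)
  have L_u: "ar G (Ide P p', ar L (v, x)) \<cdot>\<^bsub>B\<^esub> u p' X' = ar G (v, Ide A (l p X)) \<cdot>\<^bsub>B\<^esub> (u p X \<cdot>\<^bsub>B\<^esub> x)"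
    if "v \<in> Arr P" "x \<in> Arr B" "Dom P v = p" "Cod P v = p'" "Dom B x = X'" "Cod B x = X"
    for v x p p' X X'
    using L_lifts[OF that(1,2)] that by (auto simp: lifts_def)
  have nat: "ar G (Ide P p', y \<cdot>\<^bsub>A\<^esub> f \<cdot>\<^bsub>A\<^esub> ar L (v, x)) \<cdot>\<^bsub>B\<^esub> u p' X' =
      ar G (v, y) \<cdot>\<^bsub>B\<^esub> (ar G (Ide P p, f) \<cdot>\<^bsub>B\<^esub> u p X) \<cdot>\<^bsub>B\<^esub> x"
    if v: "v \<in> hom P p p'" and x: "x \<in> hom B X' X" and y: "y \<in> hom A Y Y'"
      and f: "f \<in> hom A (l p X) Y" for p p' v X X' x Y Y' y f
  proof -
    have obj [simp]: "p \<in> Obj P" "p' \<in> Obj P" "X \<in> Obj B" "X' \<in> Obj B" "Y \<in> Obj A" "Y' \<in> Obj A"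
      using P.hom_obj[OF v] target.hom_obj[OF x] A.hom_obj[OF y] by auto
    note [simp] = v[unfolded hom_def, simplified] x[unfolded hom_def, simplified]
      y[unfolded hom_def, simplified] f[unfolded hom_def, simplified]
    have "ar G (Ide P p', y \<cdot>\<^bsub>A\<^esub> f \<cdot>\<^bsub>A\<^esub> ar L (v, x)) = ar G (Ide P p', y \<cdot>\<^bsub>A\<^esub> f) \<cdot>\<^bsub>B\<^esub> ar G (Ide P p', ar L (v, x))"
      by (simp add: bi_comp)
    then have "ar G (Ide P p', y \<cdot>\<^bsub>A\<^esub> f \<cdot>\<^bsub>A\<^esub> ar L (v, x)) \<cdot>\<^bsub>B\<^esub> u p' X' =
        ar G (Ide P p', y \<cdot>\<^bsub>A\<^esub> f) \<cdot>\<^bsub>B\<^esub> (ar G (Ide P p', ar L (v, x)) \<cdot>\<^bsub>B\<^esub> u p' X')"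
      by simp
    also have "\<dots> = ar G (Ide P p', y \<cdot>\<^bsub>A\<^esub> f) \<cdot>\<^bsub>B\<^esub> (ar G (v, Ide A (l p X)) \<cdot>\<^bsub>B\<^esub> (u p X \<cdot>\<^bsub>B\<^esub> x))"
      using L_u[of v x p p' X' X] by simp
    also have "\<dots> = ar G (v, y \<cdot>\<^bsub>A\<^esub> f) \<cdot>\<^bsub>B\<^esub> (u p X \<cdot>\<^bsub>B\<^esub> x)"
      by (simp add: bi_comp_tail)
    also have "\<dots> = ar G (v, y) \<cdot>\<^bsub>B\<^esub> (ar G (Ide P p, f) \<cdot>\<^bsub>B\<^esub> u p X) \<cdot>\<^bsub>B\<^esub> x"
      by (simp add: bi_comp_tail)
    finally show ?thesis .
  qed
  have L_id: "ar L (Ide P p, Ide B X) = Ide A (l p X)" if "p \<in> Obj P" "X \<in> Obj B" for p X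
    by (rule L_eq) (use that in \<open>simp_all add: lifts_def A.id_hom\<close>)
  have L_comp: "ar L (v' \<cdot>\<^bsub>P\<^esub> v, x \<cdot>\<^bsub>B\<^esub> x') = ar L (v, x) \<cdot>\<^bsub>A\<^esub> ar L (v', x')"
    if "v \<in> Arr P" "v' \<in> Arr P" "Dom P v' = Cod P v" "x \<in> Arr B" "x' \<in> Arr B" "Dom B x = Cod B x'"
    for v v' x x'
  proof (rule L_eq)
    obtain p p' X X' where eqs: "p = Dom P v" "p' = Cod P v" "X' = Dom B x" "X = Cod B x"
      by blast
    have obj [simp]: "p \<in> Obj P" "p' \<in> Obj P" "X \<in> Obj B" "X' \<in> Obj B"
      using that by (auto simp: eqs P.dom_obj P.cod_obj target.dom_obj target.cod_obj)
    have [simp]: "Dom P v = p" "Cod P v = p'" "Dom P v' = p'" "Dom B x = X'" "Cod B x = X" "Cod B x' = X'"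
      "Cod P v' \<in> Obj P" "Dom B x' \<in> Obj B"
      using that by (auto simp: eqs P.dom_obj P.cod_obj target.dom_obj target.cod_obj)
    note [simp] = that(1,2,4,5)
    have "ar G (Ide P (Cod P v'), Ide A (l p X) \<cdot>\<^bsub>A\<^esub> ar L (v, x) \<cdot>\<^bsub>A\<^esub> ar L (v', x')) \<cdot>\<^bsub>B\<^esub> u (Cod P v') (Dom B x') =
      ar G (v', Ide A (l p X)) \<cdot>\<^bsub>B\<^esub> (ar G (Ide P p', ar L (v, x)) \<cdot>\<^bsub>B\<^esub> u p' X') \<cdot>\<^bsub>B\<^esub> x'"
      by (rule nat) (simp_all add: hom_def)
    also have "\<dots> = ar G (v', Ide A (l p X)) \<cdot>\<^bsub>B\<^esub> (ar G (v, Ide A (l p X)) \<cdot>\<^bsub>B\<^esub> (u p X \<cdot>\<^bsub>B\<^esub> x)) \<cdot>\<^bsub>B\<^esub> x'"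
      using L_u[of v x p p' X' X] by simp
    also have "\<dots> = ar G (v' \<cdot>\<^bsub>P\<^esub> v, Ide A (l p X)) \<cdot>\<^bsub>B\<^esub> (u p X \<cdot>\<^bsub>B\<^esub> (x \<cdot>\<^bsub>B\<^esub> x'))"
      by (simp add: bi_comp_tail)
    finally show "lifts (v' \<cdot>\<^bsub>P\<^esub> v) (x \<cdot>\<^bsub>B\<^esub> x') (ar L (v, x) \<cdot>\<^bsub>A\<^esub> ar L (v', x'))"
      unfolding lifts_def by (simp add: hom_def)
  qed (use that in simp_all)
  have "is_functor (prod_cat (op_cat P) B) A L"
  proof -
    interpret PB: category "prod_cat (op_cat P) B"
      by (rule category_prod category_op)+ unfold_locales
    have ob_L: "ob L (p, X) = l p X" for p X by (simp add: L_def)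
    show ?thesis
      by unfold_locales (auto simp: hom_def ob_L L_id L_comp)
  qed
  moreover have "bij_betw (\<lambda>f. ar G (Ide P p, f) \<cdot>\<^bsub>B\<^esub> u p X) (hom A (ob L (p, X)) Y) (hom B X (ob G (p, Y)))"
    if pXY: "p \<in> Obj P" "X \<in> Obj B" "Y \<in> Obj A" for p X Y
    unfolding bij_betw_def
  proof
    show "inj_on (\<lambda>f. ar G (Ide P p, f) \<cdot>\<^bsub>B\<^esub> u p X) (hom A (ob L (p, X)) Y)"
      using universal_arrow_eqI[OF U functor_slice] pXY by (auto simp: inj_on_def L_def)
    show "(\<lambda>f. ar G (Ide P p, f) \<cdot>\<^bsub>B\<^esub> u p X) ` hom A (ob L (p, X)) Y = hom B X (ob G (p, Y))"
    proof
      show "hom B X (ob G (p, Y)) \<subseteq> (\<lambda>f. ar G (Ide P p, f) \<cdot>\<^bsub>B\<^esub> u p X) ` hom A (ob L (p, X)) Y"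
      proof
        fix h assume "h \<in> hom B X (ob G (p, Y))"
        then obtain g where "g \<in> hom A (l p X) Y" "ar G (Ide P p, g) \<cdot>\<^bsub>B\<^esub> u p X = h"
          using universal_arrow_ex1[OF U[OF pXY(1,2)], of h Y] pXY by auto
        then show "h \<in> (\<lambda>f. ar G (Ide P p, f) \<cdot>\<^bsub>B\<^esub> u p X) ` hom A (ob L (p, X)) Y"
          by (auto simp: L_def)
      qed
    qed (use pXY in \<open>auto simp: L_def hom_def\<close>)
  qed
  ultimately show ?thesis
    by (rule that[of L "\<lambda>p X Y f. ar G (Ide P p, f) \<cdot>\<^bsub>B\<^esub> u p X"]) (use nat in \<open>auto simp: L_def\<close>)
qed

text \<open>
  Tensors are the left adjoints of the functors \<open>\<langle>-, V\<rangle>\<close>, and mapping objects are the left adjoints of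
  the functors \<open>\<langle>Y, -\<rangle>\<close> defined on the opposite of \<open>E\<close>: the representability of
  \<open>V \<mapsto> hom(X, \<langle>Y, V\<rangle>)\<close> says exactly that.  Both bijections therefore come from the same lemma on
  parametrised adjunctions, with the parameter running over \<open>E\<close> in one case and over \<open>D\<close> in the
  other.
\<close>

theorem enriched_tensored_cotensored_if_universal:
  assumes "monoidal_category E S" and K: "cotensorisation E S D K"
    and tens: "\<And>V. V \<in> Obj E \<Longrightarrow> has_universal_arrows D D (slice (op_cat E) (swap_args (cot K)) V)"
    and enr: "\<And>Y. Y \<in> Obj D \<Longrightarrow> has_universal_arrows (op_cat E) D (slice D (cot K) Y)"
  shows "\<exists>T H \<phi> \<psi>. enriched_tensored_cotensored E S D T H K \<phi> \<psi>"
proof -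
  interpret E: monoidal_category E S by fact
  interpret opE: category "op_cat E" by (rule category_op) unfold_locales
  have cot_functor: "is_functor (prod_cat D (op_cat E)) D (cot K)"
    using K by (simp add: cotensorisation_def)
  then interpret D: category D by (simp add: is_functor_def)
  interpret K: bifunctor D "op_cat E" D "cot K"
    by (intro bifunctor.intro cot_functor D.category_axioms opE.category_axioms)
  interpret K': bifunctor "op_cat E" D D "swap_args (cot K)"
    by (intro bifunctor.intro K.functor_swap D.category_axioms opE.category_axioms)
  obtain T \<theta> where T: "is_functor (prod_cat E D) D T"
    and \<theta>: "\<And>V X Y. \<lbrakk>V \<in> Obj E; X \<in> Obj D; Y \<in> Obj D\<rbrakk> \<Longrightarrow>
      bij_betw (\<theta> V X Y) (hom D (ob T (V, X)) Y) (hom D X (ob (cot K) (Y, V)))"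
    and \<theta>_nat: "\<And>V V' v X X' x Y Y' y f. \<lbrakk>v \<in> hom E V' V; x \<in> hom D X' X; y \<in> hom D Y Y';
        f \<in> hom D (ob T (V, X)) Y\<rbrakk> \<Longrightarrow>
      \<theta> V' X' Y' (y \<cdot>\<^bsub>D\<^esub> f \<cdot>\<^bsub>D\<^esub> ar T (v, x)) = ar (cot K) (y, v) \<cdot>\<^bsub>D\<^esub> \<theta> V X Y f \<cdot>\<^bsub>D\<^esub> x"
    by (rule K'.parametrised_adjunction[simplified], erule tens) (rule that)
  obtain L t where L: "is_functor (prod_cat (op_cat D) D) (op_cat E) L"
    and t: "\<And>Y X V. \<lbrakk>Y \<in> Obj D; X \<in> Obj D; V \<in> Obj E\<rbrakk> \<Longrightarrow>
      bij_betw (t Y X V) (hom E V (ob L (Y, X))) (hom D X (ob (cot K) (Y, V)))"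
    and t_nat: "\<And>Y Y' y X X' x V V' v f. \<lbrakk>y \<in> hom D Y Y'; x \<in> hom D X' X; v \<in> hom E V' V;
        f \<in> hom E V (ob L (Y, X))\<rbrakk> \<Longrightarrow>
      t Y' X' V' (ar L (y, x) \<cdot>\<^bsub>E\<^esub> (f \<cdot>\<^bsub>E\<^esub> v)) = ar (cot K) (y, v) \<cdot>\<^bsub>D\<^esub> t Y X V f \<cdot>\<^bsub>D\<^esub> x"
    by (rule K.parametrised_adjunction[simplified], erule enr) (rule that)
  \<comment> \<open>\<open>L\<close> takes values in the opposite of \<open>E\<close> and has its arguments in the order \<open>(Y, X)\<close>.\<close>
  define H where "H = swap_args L"
  define \<psi> where "\<psi> V X Y = t Y X V" for V X Y
  \<comment> \<open>\<open>\<theta>\<close> is the composite \<open>hom(V \<boxtimes> X, Y) \<simeq> hom(X, \<langle>Y, V\<rangle>)\<close>, so \<open>\<phi>\<close> is \<open>\<theta>\<close> followed by the inverse of \<open>\<psi>\<close>.\<close>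
  define \<phi> where "\<phi> V X Y f = the_inv_into (hom E V (ob H (X, Y))) (\<psi> V X Y) (\<theta> V X Y f)" for V X Y f
  have H: "is_functor (prod_cat (op_cat D) D) E H"
  proof -
    interpret opD: category "op_cat D" by (rule category_op) unfold_locales
    have "is_functor (prod_cat D (op_cat D)) E L"
      using is_functor.functor_op[OF L] by (simp add: op_prod)
    then interpret bifunctor D "op_cat D" E L
      by (intro bifunctor.intro D.category_axioms opD.category_axioms)
    show ?thesis using functor_swap by (simp add: H_def)
  qed
  interpret T: bifunctor E D D T
    by (intro bifunctor.intro T D.category_axioms E.category_axioms)
  interpret H: bifunctor "op_cat D" D E H
    by (intro bifunctor.intro H category_op D.category_axioms)
  have \<psi>: "bij_betw (\<psi> V X Y) (hom E V (ob H (X, Y))) (hom D X (ob (cot K) (Y, V)))"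
    if "V \<in> Obj E" "X \<in> Obj D" "Y \<in> Obj D" for V X Y
    using t[of Y X V] that by (simp add: \<psi>_def H_def)
  have \<psi>_nat: "\<psi> V' X' Y' (ar H (x, y) \<cdot>\<^bsub>E\<^esub> h \<cdot>\<^bsub>E\<^esub> v) = ar (cot K) (y, v) \<cdot>\<^bsub>D\<^esub> \<psi> V X Y h \<cdot>\<^bsub>D\<^esub> x"
    if "v \<in> hom E V' V" "x \<in> hom D X' X" "y \<in> hom D Y Y'" "h \<in> hom E V (ob H (X, Y))"
    for v x y h V V' X X' Y Y'
  proof -
    have "ar H (x, y) \<cdot>\<^bsub>E\<^esub> h \<cdot>\<^bsub>E\<^esub> v = ar L (y, x) \<cdot>\<^bsub>E\<^esub> (h \<cdot>\<^bsub>E\<^esub> v)"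
      using that H.bi_arr[of x y] H.bi_dom[of x y]
      by (subst E.assoc_arr) (simp_all add: hom_def H_def)
    with that t_nat[of y Y Y' x X' X v V' V h] show ?thesis by (simp add: \<psi>_def H_def)
  qed
  have \<phi>: "bij_betw (\<phi> V X Y) (hom D (ob T (V, X)) Y) (hom E V (ob H (X, Y)))"
    if "V \<in> Obj E" "X \<in> Obj D" "Y \<in> Obj D" for V X Y
    using bij_betw_trans[OF \<theta>[OF that] bij_betw_the_inv_into[OF \<psi>[OF that]]]
    by (simp add: \<phi>_def[abs_def] comp_def)
  have \<psi>_\<phi>: "\<psi> V X Y (\<phi> V X Y f) = \<theta> V X Y f"
    if "V \<in> Obj E" "X \<in> Obj D" "Y \<in> Obj D" "f \<in> hom D (ob T (V, X)) Y" for V X Y f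
    unfolding \<phi>_def
    using f_the_inv_into_f_bij_betw[OF \<psi>[OF that(1-3)], of "\<theta> V X Y f"]
      bij_betwE[OF \<theta>[OF that(1-3)]] that by blast
  have \<phi>_nat: "\<phi> V' X' Y' (y \<cdot>\<^bsub>D\<^esub> f \<cdot>\<^bsub>D\<^esub> ar T (v, x)) = ar H (x, y) \<cdot>\<^bsub>E\<^esub> \<phi> V X Y f \<cdot>\<^bsub>E\<^esub> v"
    if v: "v \<in> hom E V' V" and x: "x \<in> hom D X' X" and y: "y \<in> hom D Y Y'"
      and f: "f \<in> hom D (ob T (V, X)) Y" for v x y f V V' X X' Y Y'
  proof -
    have obj: "V \<in> Obj E" "V' \<in> Obj E" "X \<in> Obj D" "X' \<in> Obj D" "Y \<in> Obj D" "Y' \<in> Obj D"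
      using E.hom_obj[OF v] D.hom_obj[OF x] D.hom_obj[OF y] by auto
    let ?g = "y \<cdot>\<^bsub>D\<^esub> f \<cdot>\<^bsub>D\<^esub> ar T (v, x)" and ?h = "ar H (x, y) \<cdot>\<^bsub>E\<^esub> \<phi> V X Y f \<cdot>\<^bsub>E\<^esub> v"
    have g: "?g \<in> hom D (ob T (V', X')) Y'"
      using v x y f by (simp add: hom_def)
    have h: "\<phi> V X Y f \<in> hom E V (ob H (X, Y))"
      using bij_betwE[OF \<phi>] obj f by blast
    then have h': "?h \<in> hom E V' (ob H (X', Y'))"
      using v x y by (simp add: hom_def)
    have "\<psi> V' X' Y' (\<phi> V' X' Y' ?g) = \<psi> V' X' Y' ?h"
      using \<psi>_\<phi> obj g f \<theta>_nat[OF v x y f] \<psi>_nat[OF v x y h] by simp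
    moreover have "\<phi> V' X' Y' ?g \<in> hom E V' (ob H (X', Y'))"
      using bij_betwE[OF \<phi>] obj g by blast
    ultimately show ?thesis
      using h' \<psi>[of V' X' Y'] obj by (auto simp: bij_betw_def inj_on_def)
  qed
  have "enriched_tensored_cotensored E S D T H K \<phi> \<psi>"
    by unfold_locales (fact T H K \<phi> \<psi> \<phi>_nat \<psi>_nat)+
  then show ?thesis by blast
qed

section \<open>Universal arrows at a coequaliser\<close>

lemma is_coequaliserI:
  assumes "f \<in> hom C A B" "g \<in> hom C A B" "q \<in> hom C B E" "q \<cdot>\<^bsub>C\<^esub> f = q \<cdot>\<^bsub>C\<^esub> g"
    and "\<And>Z h. \<lbrakk>h \<in> hom C B Z; h \<cdot>\<^bsub>C\<^esub> f = h \<cdot>\<^bsub>C\<^esub> g\<rbrakk> \<Longrightarrow> \<exists>!k. k \<in> hom C E Z \<and> k \<cdot>\<^bsub>C\<^esub> q = h"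
  shows "is_coequaliser C f g q"
  unfolding is_coequaliser_def
  by (intro exI[of _ A] exI[of _ B] exI[of _ E] conjI allI ballI impI assms)

lemma is_coequaliser_hom:
  assumes "is_coequaliser C f g q" "f \<in> hom C A B"
  obtains E where "g \<in> hom C A B" "q \<in> hom C B E" "q \<cdot>\<^bsub>C\<^esub> f = q \<cdot>\<^bsub>C\<^esub> g"
    "\<And>Z h. \<lbrakk>h \<in> hom C B Z; h \<cdot>\<^bsub>C\<^esub> f = h \<cdot>\<^bsub>C\<^esub> g\<rbrakk> \<Longrightarrow> \<exists>!k. k \<in> hom C E Z \<and> k \<cdot>\<^bsub>C\<^esub> q = h"
proof -
  obtain A' B' E where E: "f \<in> hom C A' B'" "g \<in> hom C A' B'" "q \<in> hom C B' E" "q \<cdot>\<^bsub>C\<^esub> f = q \<cdot>\<^bsub>C\<^esub> g"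
    "\<forall>Z. \<forall>h \<in> hom C B' Z. h \<cdot>\<^bsub>C\<^esub> f = h \<cdot>\<^bsub>C\<^esub> g \<longrightarrow> (\<exists>!k. k \<in> hom C E Z \<and> k \<cdot>\<^bsub>C\<^esub> q = h)"
    using assms(1) unfolding is_coequaliser_def by (elim exE conjE)
  moreover have "A' = A" "B' = B" using E(1) assms(2) by (auto simp: hom_def)
  ultimately show ?thesis using that by simp
qed

lemma (in category) coequaliser_epi:
  assumes "is_coequaliser C f g q" "k \<in> Arr C" "k' \<in> Arr C" "Dom C k = Cod C q" "Dom C k' = Cod C q"
    "k \<cdot> q = k' \<cdot> q"
  shows "k = k'"
proof -
  obtain A B E where fg: "f \<in> hom C A B" "g \<in> hom C A B" "q \<in> hom C B E" "q \<cdot> f = q \<cdot> g"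
    "\<forall>Z. \<forall>h \<in> hom C B Z. h \<cdot> f = h \<cdot> g \<longrightarrow> (\<exists>!k. k \<in> hom C E Z \<and> k \<cdot> q = h)"
    using assms(1) unfolding is_coequaliser_def by (elim exE conjE)
  have q: "q \<in> Arr C" using fg by (simp add: hom_def)
  then have c: "Cod C k' = Cod C k"
    using cod_comp[of q k] cod_comp[of q k'] assms(2-6) by simp
  have "(k \<cdot> q) \<cdot> f = (k \<cdot> q) \<cdot> g" using assms(2,4) fg(1-4) by (simp add: hom_def)
  moreover have "k \<cdot> q \<in> hom C B (Cod C k)" using assms(2,4) fg(3) by (simp add: hom_def)
  ultimately have "\<exists>!j. j \<in> hom C E (Cod C k) \<and> j \<cdot> q = k \<cdot> q" using fg(5) by blast
  moreover have "k \<in> hom C E (Cod C k)" "k' \<in> hom C E (Cod C k)"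
    using assms(2-5) fg(3) c by (auto simp: hom_def)
  ultimately show ?thesis using assms(6) by metis
qed

text \<open>
  If \<open>X\<close> is the coequaliser of \<open>X1 \<rightrightarrows> X0\<close>, then \<open>hom(X, G -)\<close> is the equaliser of
  \<open>hom(X0, G -) \<rightrightarrows> hom(X1, G -)\<close>.  When the latter two are represented by \<open>L0\<close> and \<open>L1\<close>, the two maps
  come from a pair \<open>L1 \<rightrightarrows> L0\<close>, and a coequaliser of this pair represents \<open>hom(X, G -)\<close>.  The
  transpose of a common section is again a common section, so a reflexive pair yields a reflexive
  pair.
\<close>

lemma universal_arrow_coequaliser:
  assumes G: "is_functor A B G" and A: "has_reflexive_coequalisers A"
    and refl: "reflexive_pair B f g" and q: "is_coequaliser B f g q"
    and u1: "universal_arrow A B G (Dom B f) L1 u1" and u0: "universal_arrow A B G (Cod B f) L0 u0"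
  shows "\<exists>L u. universal_arrow A B G (Cod B q) L u"
proof -
  interpret G: is_functor A B G by fact
  obtain X1 X0 s where fg: "f \<in> hom B X1 X0" "g \<in> hom B X1 X0" "s \<in> hom B X0 X1"
    "f \<cdot>\<^bsub>B\<^esub> s = Ide B X0" "g \<cdot>\<^bsub>B\<^esub> s = Ide B X0"
    using refl unfolding reflexive_pair_def by blast
  obtain X where qX: "q \<in> hom B X0 X" "q \<cdot>\<^bsub>B\<^esub> f = q \<cdot>\<^bsub>B\<^esub> g"
    and q_univ: "\<And>Z h. \<lbrakk>h \<in> hom B X0 Z; h \<cdot>\<^bsub>B\<^esub> f = h \<cdot>\<^bsub>B\<^esub> g\<rbrakk> \<Longrightarrow> \<exists>!k. k \<in> hom B X Z \<and> k \<cdot>\<^bsub>B\<^esub> q = h"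
    by (rule is_coequaliser_hom[OF q fg(1)]) (rule that)
  have [simp]: "f \<in> Arr B" "Dom B f = X1" "Cod B f = X0" "g \<in> Arr B" "Dom B g = X1" "Cod B g = X0"
    "s \<in> Arr B" "Dom B s = X0" "Cod B s = X1" "q \<in> Arr B" "Dom B q = X0" "Cod B q = X"
    using fg qX by (auto simp: hom_def)
  have obj [simp]: "X0 \<in> Obj B" "X1 \<in> Obj B" "X \<in> Obj B"
    using G.target.hom_obj[OF fg(1)] G.target.hom_obj[OF qX(1)] by auto
  have L [simp]: "L0 \<in> Obj A" "L1 \<in> Obj A" and
    u [simp]: "u1 \<in> Arr B" "Dom B u1 = X1" "Cod B u1 = ob G L1"
    "u0 \<in> Arr B" "Dom B u0 = X0" "Cod B u0 = ob G L0"
    using universal_arrowD[OF u1] universal_arrowD[OF u0] by (auto simp: hom_def)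
  have lift: "\<exists>k. k \<in> Arr A \<and> Dom A k = L1 \<and> Cod A k = L0 \<and> ar G k \<cdot>\<^bsub>B\<^esub> u1 = u0 \<cdot>\<^bsub>B\<^esub> f'"
    if "f' \<in> hom B X1 X0" for f'
  proof -
    have "u0 \<cdot>\<^bsub>B\<^esub> f' \<in> hom B X1 (ob G L0)" using that by (simp add: hom_def)
    then show ?thesis using universal_arrow_ex1[OF u1, of "u0 \<cdot>\<^bsub>B\<^esub> f'" L0] by (auto simp: hom_def)
  qed
  obtain f' where f' [simp]: "f' \<in> Arr A" "Dom A f' = L1" "Cod A f' = L0" "ar G f' \<cdot>\<^bsub>B\<^esub> u1 = u0 \<cdot>\<^bsub>B\<^esub> f"
    using lift[OF fg(1)] by blast
  obtain g' where g' [simp]: "g' \<in> Arr A" "Dom A g' = L1" "Cod A g' = L0" "ar G g' \<cdot>\<^bsub>B\<^esub> u1 = u0 \<cdot>\<^bsub>B\<^esub> g"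
    using lift[OF fg(2)] by blast
  have "u1 \<cdot>\<^bsub>B\<^esub> s \<in> hom B X0 (ob G L1)" by (simp add: hom_def)
  then obtain s' where s' [simp]: "s' \<in> Arr A" "Dom A s' = L0" "Cod A s' = L1" "ar G s' \<cdot>\<^bsub>B\<^esub> u0 = u1 \<cdot>\<^bsub>B\<^esub> s"
    using universal_arrow_ex1[OF u0, of "u1 \<cdot>\<^bsub>B\<^esub> s" L1] by (auto simp: hom_def)
  have sect: "k \<cdot>\<^bsub>A\<^esub> s' = Ide A L0"
    if "k \<in> Arr A" "Dom A k = L1" "Cod A k = L0" "ar G k \<cdot>\<^bsub>B\<^esub> u1 = u0 \<cdot>\<^bsub>B\<^esub> k'"
      "k' \<in> hom B X1 X0" "k' \<cdot>\<^bsub>B\<^esub> s = Ide B X0" for k k'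
  proof (rule universal_arrow_eqI[OF u0[simplified] G])
    show "ar G (k \<cdot>\<^bsub>A\<^esub> s') \<cdot>\<^bsub>B\<^esub> u0 = ar G (Ide A L0) \<cdot>\<^bsub>B\<^esub> u0"
      using that G.target.comp_cong_tail[OF that(4), of s] by (simp add: G.ar_comp_arr hom_def)
  qed (use that in \<open>auto simp: hom_def\<close>)
  have "reflexive_pair A f' g'"
    unfolding reflexive_pair_def
    by (intro exI[of _ L1] exI[of _ L0] conjI bexI[of _ s'])
      (use sect[of f' f] sect[of g' g] fg in \<open>auto simp: hom_def\<close>)
  then obtain q' where q': "is_coequaliser A f' g' q'"
    using A by (auto simp: has_reflexive_coequalisers_def)
  from q' obtain L where q'L: "q' \<in> hom A L0 L" "q' \<cdot>\<^bsub>A\<^esub> f' = q' \<cdot>\<^bsub>A\<^esub> g'"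
    and q'_univ: "\<And>Z h. \<lbrakk>h \<in> hom A L0 Z; h \<cdot>\<^bsub>A\<^esub> f' = h \<cdot>\<^bsub>A\<^esub> g'\<rbrakk> \<Longrightarrow> \<exists>!k. k \<in> hom A L Z \<and> k \<cdot>\<^bsub>A\<^esub> q' = h"
    by (rule is_coequaliser_hom[of _ _ _ _ L1 L0]) (simp_all add: hom_def that)
  have [simp]: "q' \<in> Arr A" "Dom A q' = L0" "Cod A q' = L" "L \<in> Obj A"
    using G.source.hom_obj[OF q'L(1)] q'L(1) by (auto simp: hom_def)
  \<comment> \<open>A morphism out of \<open>L0\<close> coequalises \<open>f'\<close> and \<open>g'\<close> iff its transpose coequalises \<open>f\<close> and \<open>g\<close>.\<close>
  have transpose: "(ar G k \<cdot>\<^bsub>B\<^esub> u0) \<cdot>\<^bsub>B\<^esub> f = ar G (k \<cdot>\<^bsub>A\<^esub> f') \<cdot>\<^bsub>B\<^esub> u1"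
    "(ar G k \<cdot>\<^bsub>B\<^esub> u0) \<cdot>\<^bsub>B\<^esub> g = ar G (k \<cdot>\<^bsub>A\<^esub> g') \<cdot>\<^bsub>B\<^esub> u1" if "k \<in> Arr A" "Dom A k = L0" for k
    using that by (simp_all add: G.ar_comp_arr)
  have "\<exists>!u. u \<in> hom B X (ob G L) \<and> u \<cdot>\<^bsub>B\<^esub> q = ar G q' \<cdot>\<^bsub>B\<^esub> u0"
    using transpose[of q'] q'L(2) by (intro q_univ) (simp_all add: hom_def)
  then obtain u where u_eq: "u \<cdot>\<^bsub>B\<^esub> q = ar G q' \<cdot>\<^bsub>B\<^esub> u0" and [simp]: "u \<in> Arr B" "Dom B u = X" "Cod B u = ob G L"
    by (auto simp: hom_def)
  have uq: "(ar G k \<cdot>\<^bsub>B\<^esub> u) \<cdot>\<^bsub>B\<^esub> q = ar G (k \<cdot>\<^bsub>A\<^esub> q') \<cdot>\<^bsub>B\<^esub> u0" if "k \<in> Arr A" "Dom A k = L" for k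
    using that by (simp add: G.ar_comp_arr u_eq)
  have "\<exists>!k. k \<in> hom A L Y \<and> ar G k \<cdot>\<^bsub>B\<^esub> u = h" if Y: "Y \<in> Obj A" and "h \<in> hom B X (ob G Y)" for Y h
  proof -
    have h [simp]: "h \<in> Arr B" "Dom B h = X" "Cod B h = ob G Y" using that by (auto simp: hom_def)
    have "h \<cdot>\<^bsub>B\<^esub> q \<in> hom B X0 (ob G Y)" by (simp add: hom_def)
    then obtain k0 where k0 [simp]: "k0 \<in> Arr A" "Dom A k0 = L0" "Cod A k0 = Y" "ar G k0 \<cdot>\<^bsub>B\<^esub> u0 = h \<cdot>\<^bsub>B\<^esub> q"
      using universal_arrow_ex1[OF u0, of "h \<cdot>\<^bsub>B\<^esub> q" Y] Y by (auto simp: hom_def)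
    have "ar G (k0 \<cdot>\<^bsub>A\<^esub> f') \<cdot>\<^bsub>B\<^esub> u1 = ar G (k0 \<cdot>\<^bsub>A\<^esub> g') \<cdot>\<^bsub>B\<^esub> u1"
      using transpose[of k0] qX(2) by simp
    then have "k0 \<cdot>\<^bsub>A\<^esub> f' = k0 \<cdot>\<^bsub>A\<^esub> g'"
      by - (rule universal_arrow_eqI[OF u1[simplified] G, of _ Y], simp_all add: hom_def)
    then obtain k where k [simp]: "k \<in> Arr A" "Dom A k = L" "Cod A k = Y" "k \<cdot>\<^bsub>A\<^esub> q' = k0"
      using q'_univ[of k0 Y] by (auto simp: hom_def)
    show ?thesis
    proof (rule ex1I[of _ k])
      have "(ar G k \<cdot>\<^bsub>B\<^esub> u) \<cdot>\<^bsub>B\<^esub> q = h \<cdot>\<^bsub>B\<^esub> q" using uq[of k] by simp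
      then have "ar G k \<cdot>\<^bsub>B\<^esub> u = h" by - (rule G.target.coequaliser_epi[OF q], simp_all)
      then show "k \<in> hom A L Y \<and> ar G k \<cdot>\<^bsub>B\<^esub> u = h" by (simp add: hom_def)
    next
      fix k' assume k': "k' \<in> hom A L Y \<and> ar G k' \<cdot>\<^bsub>B\<^esub> u = h"
      then have [simp]: "k' \<in> Arr A" "Dom A k' = L" "Cod A k' = Y" by (auto simp: hom_def)
      have "ar G (k' \<cdot>\<^bsub>A\<^esub> q') \<cdot>\<^bsub>B\<^esub> u0 = ar G k0 \<cdot>\<^bsub>B\<^esub> u0"
        using uq[of k'] k' by (simp only: \<open>k' \<in> Arr A\<close> \<open>Dom A k' = L\<close> k0)
      then have "k' \<cdot>\<^bsub>A\<^esub> q' = k \<cdot>\<^bsub>A\<^esub> q'"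
        by - (rule universal_arrow_eqI[OF u0[simplified] G, of _ Y], simp_all add: hom_def)
      then show "k' = k" by - (rule G.source.coequaliser_epi[OF q'], simp_all)
    qed
  qed
  then have "universal_arrow A B G X L u"
    by (intro universal_arrowI) (simp_all add: hom_def)
  then show ?thesis by auto
qed

section \<open>Algebras\<close>

lemma Alg_simps [simp]:
  "Dom (Alg D M m e) (A, B, f) = A" "Cod (Alg D M m e) (A, B, f) = B"
  "Ide (Alg D M m e) A = (A, A, Ide D (fst A))"
  "(B, B', g) \<cdot>\<^bsub>Alg D M m e\<^esub> (A, A', f) = (A, B', g \<cdot>\<^bsub>D\<^esub> f)"
  by (simp_all add: Alg_def Let_def)

lemma Alg_obj:
  "(X, a) \<in> Obj (Alg D M m e) \<longleftrightarrow> X \<in> Obj D \<and> a \<in> Arr D \<and> Dom D a = ob M X \<and> Cod D a = X \<and>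
    a \<cdot>\<^bsub>D\<^esub> e X = Ide D X \<and> a \<cdot>\<^bsub>D\<^esub> m X = a \<cdot>\<^bsub>D\<^esub> ar M a"
  by (auto simp: Alg_def Let_def hom_def)

lemma Alg_arr:
  "((X, a), (Y, b), f) \<in> Arr (Alg D M m e) \<longleftrightarrow>
    (X, a) \<in> Obj (Alg D M m e) \<and> (Y, b) \<in> Obj (Alg D M m e) \<and>
    f \<in> Arr D \<and> Dom D f = X \<and> Cod D f = Y \<and> f \<cdot>\<^bsub>D\<^esub> a = b \<cdot>\<^bsub>D\<^esub> ar M f"
  by (auto simp: Alg_def Let_def hom_def)

lemma Alg_hom:
  "F \<in> hom (Alg D M m e) (X, a) (Y, b) \<longleftrightarrow> (\<exists>f. F = ((X, a), (Y, b), f) \<and> F \<in> Arr (Alg D M m e))"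
  by (cases F) (auto simp: hom_def)

lemma forget_simps [simp]: "ob forget A = fst A" "ar forget (A, B, f) = f"
  by (simp_all add: forget_def)

context monad
begin

abbreviation "alg \<equiv> Alg D M m e"

lemma e_arr [simp]: "X \<in> Obj D \<Longrightarrow> e X \<in> Arr D"
  and e_dom [simp]: "X \<in> Obj D \<Longrightarrow> Dom D (e X) = X"
  and e_cod [simp]: "X \<in> Obj D \<Longrightarrow> Cod D (e X) = ob M X"
  and m_arr [simp]: "X \<in> Obj D \<Longrightarrow> m X \<in> Arr D"
  and m_dom [simp]: "X \<in> Obj D \<Longrightarrow> Dom D (m X) = ob M (ob M X)"
  and m_cod [simp]: "X \<in> Obj D \<Longrightarrow> Cod D (m X) = ob M X"
  using nat_trans.component_hom[OF unit, of X] nat_trans.component_hom[OF mult, of X]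
  by (auto simp: hom_def comp_funct_def id_funct_def)

lemma e_nat: "\<lbrakk>f \<in> Arr D; Dom D f = X; Cod D f = Y\<rbrakk> \<Longrightarrow> e Y \<cdot>\<^bsub>D\<^esub> f = ar M f \<cdot>\<^bsub>D\<^esub> e X"
  using nat_trans.natural[OF unit, of f X Y] by (simp add: hom_def id_funct_def)

lemma m_nat: "\<lbrakk>f \<in> Arr D; Dom D f = X; Cod D f = Y\<rbrakk> \<Longrightarrow> m Y \<cdot>\<^bsub>D\<^esub> ar M (ar M f) = ar M f \<cdot>\<^bsub>D\<^esub> m X"
  using nat_trans.natural[OF mult, of f X Y] by (simp add: hom_def comp_funct_def)

lemma category_Alg: "category alg"
proof
  show "f \<in> Arr alg \<Longrightarrow> Dom alg f \<in> Obj alg" for f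
    by (cases f) (auto simp: Alg_arr)
  show "f \<in> Arr alg \<Longrightarrow> Cod alg f \<in> Obj alg" for f
    by (cases f) (auto simp: Alg_arr)
  show "X \<in> Obj alg \<Longrightarrow> Ide alg X \<in> hom alg X X" for X
    by (cases X) (auto simp: Alg_hom Alg_arr Alg_obj)
  show "f \<in> hom alg X Y \<Longrightarrow> f \<cdot>\<^bsub>alg\<^esub> Ide alg X = f" for f X Y
    by (cases X; cases Y) (auto simp: Alg_hom Alg_arr)
  show "f \<in> hom alg X Y \<Longrightarrow> Ide alg Y \<cdot>\<^bsub>alg\<^esub> f = f" for f X Y
    by (cases X; cases Y) (auto simp: Alg_hom Alg_arr)
  show "\<lbrakk>f \<in> hom alg W X; g \<in> hom alg X Y; h \<in> hom alg Y Z\<rbrakk> \<Longrightarrow> h \<cdot>\<^bsub>alg\<^esub> g \<cdot>\<^bsub>alg\<^esub> f = h \<cdot>\<^bsub>alg\<^esub> (g \<cdot>\<^bsub>alg\<^esub> f)"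
    for f g h W X Y Z
    by (cases X; cases Y; cases Z; cases W) (auto simp: Alg_hom Alg_arr)
  show "g \<cdot>\<^bsub>alg\<^esub> f \<in> hom alg X Z" if "f \<in> hom alg X Y" "g \<in> hom alg Y Z" for f g X Y Z
  proof -
    obtain V a W b U c where XYZ: "X = (V, a)" "Y = (W, b)" "Z = (U, c)"
      by (cases X; cases Y; cases Z) blast
    with that obtain f' g' where fg: "f = (X, Y, f')" "g = (Y, Z, g')" and
      arr: "(X, Y, f') \<in> Arr alg" "(Y, Z, g') \<in> Arr alg"
      by (auto simp: Alg_hom)
    note h = arr[unfolded XYZ Alg_arr Alg_obj]
    have [simp]: "f' \<in> Arr D" "g' \<in> Arr D" "Dom D f' = V" "Cod D f' = W" "Dom D g' = W" "Cod D g' = U"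
      "a \<in> Arr D" "b \<in> Arr D" "c \<in> Arr D" "Dom D a = ob M V" "Cod D a = V" "Dom D b = ob M W" "Cod D b = W"
      "Dom D c = ob M U" "Cod D c = U" using h by auto
    have f'a: "f' \<cdot>\<^bsub>D\<^esub> a = b \<cdot>\<^bsub>D\<^esub> ar M f'" and g'b: "g' \<cdot>\<^bsub>D\<^esub> b = c \<cdot>\<^bsub>D\<^esub> ar M g'" using h by auto
    have "g' \<cdot>\<^bsub>D\<^esub> f' \<cdot>\<^bsub>D\<^esub> a = c \<cdot>\<^bsub>D\<^esub> ar M (g' \<cdot>\<^bsub>D\<^esub> f')"
      by (simp add: f'a endo.source.comp_cong_tail[OF g'b] endo.ar_comp_arr)
    then show ?thesis
      using arr by (simp add: XYZ fg Alg_hom Alg_arr)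
  qed
qed

lemma forget_functor: "is_functor alg D forget"
proof -
  interpret alg: category alg by (rule category_Alg)
  show ?thesis
  proof
    show "f \<in> hom alg X Y \<Longrightarrow> g \<in> hom alg Y Z \<Longrightarrow>
      ar forget (g \<cdot>\<^bsub>alg\<^esub> f) = ar forget g \<cdot>\<^bsub>D\<^esub> ar forget f" for f g X Y Z
      by (cases X; cases Y; cases Z) (auto simp: Alg_hom)
    show "f \<in> hom alg X Y \<Longrightarrow> ar forget f \<in> hom D (ob forget X) (ob forget Y)" for f X Y
      by (cases X; cases Y) (auto simp: Alg_hom Alg_arr, simp add: hom_def)
    show "X \<in> Obj alg \<Longrightarrow> ob forget X \<in> Obj D" for X
      by (cases X) (auto simp: Alg_obj)
  qed simp
qed

lemma free_obj [simp]: "X \<in> Obj D \<Longrightarrow> (ob M X, m X) \<in> Obj alg"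
  using unit_left[of X] assoc[of X] by (simp add: Alg_obj)

lemma free_universal:
  assumes "X \<in> Obj D"
  shows "universal_arrow alg D forget X (ob M X, m X) (e X)"
proof -
  have "\<exists>!g. g \<in> hom alg (ob M X, m X) Y \<and> ar forget g \<cdot>\<^bsub>D\<^esub> e X = f"
    if Y: "Y \<in> Obj alg" and f: "f \<in> hom D X (ob forget Y)" for Y f
  proof -
    obtain Z a where Ya: "Y = (Z, a)" by (cases Y)
    have [simp]: "f \<in> Arr D" "Dom D f = X" "Cod D f = Z" using f by (auto simp: Ya hom_def)
    have a [simp]: "Z \<in> Obj D" "a \<in> Arr D" "Dom D a = ob M Z" "Cod D a = Z"
      and ae: "a \<cdot>\<^bsub>D\<^esub> e Z = Ide D Z" and am: "a \<cdot>\<^bsub>D\<^esub> m Z = a \<cdot>\<^bsub>D\<^esub> ar M a"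
      using Y by (auto simp: Ya Alg_obj)
    note [simp] = assms
    have "a \<cdot>\<^bsub>D\<^esub> ar M f \<cdot>\<^bsub>D\<^esub> m X = a \<cdot>\<^bsub>D\<^esub> m Z \<cdot>\<^bsub>D\<^esub> ar M (ar M f)"
      by (simp add: m_nat[of f X Z])
    also have "\<dots> = a \<cdot>\<^bsub>D\<^esub> ar M (a \<cdot>\<^bsub>D\<^esub> ar M f)"
      using endo.source.comp_cong_tail[OF am, of "ar M (ar M f)"] by (simp add: endo.ar_comp_arr)
    finally have 1: "((ob M X, m X), Y, a \<cdot>\<^bsub>D\<^esub> ar M f) \<in> Arr alg"
      using Y by (simp add: Ya Alg_arr)
    have 2: "a \<cdot>\<^bsub>D\<^esub> ar M f \<cdot>\<^bsub>D\<^esub> e X = f"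
      using endo.source.comp_cong_tail[OF ae, of f] by (simp add: e_nat[of f X Z, symmetric])
    have 3: "g = a \<cdot>\<^bsub>D\<^esub> ar M f"
      if "((ob M X, m X), Y, g) \<in> Arr alg" "g \<cdot>\<^bsub>D\<^esub> e X = f" for g
    proof -
      have [simp]: "g \<in> Arr D" "Dom D g = ob M X" "Cod D g = Z" and gm: "g \<cdot>\<^bsub>D\<^esub> m X = a \<cdot>\<^bsub>D\<^esub> ar M g"
        using that by (auto simp: Ya Alg_arr)
      have "g = g \<cdot>\<^bsub>D\<^esub> m X \<cdot>\<^bsub>D\<^esub> ar M (e X)" by (simp add: unit_right)
      also have "\<dots> = a \<cdot>\<^bsub>D\<^esub> ar M (g \<cdot>\<^bsub>D\<^esub> e X)"
        by (simp only: gm, simp add: endo.ar_comp_arr)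
      also have "\<dots> = a \<cdot>\<^bsub>D\<^esub> ar M f" by (simp only: that(2))
      finally show ?thesis .
    qed
    show ?thesis
    proof (rule ex1I[of _ "((ob M X, m X), Y, a \<cdot>\<^bsub>D\<^esub> ar M f)"])
      show "((ob M X, m X), Y, a \<cdot>\<^bsub>D\<^esub> ar M f) \<in> hom alg (ob M X, m X) Y \<and>
          ar forget ((ob M X, m X), Y, a \<cdot>\<^bsub>D\<^esub> ar M f) \<cdot>\<^bsub>D\<^esub> e X = f"
        using 1 2 by (simp add: Ya Alg_hom)
      show "G = ((ob M X, m X), Y, a \<cdot>\<^bsub>D\<^esub> ar M f)"
        if "G \<in> hom alg (ob M X, m X) Y \<and> ar forget G \<cdot>\<^bsub>D\<^esub> e X = f" for G
        using that 3[of "snd (snd G)"] by (auto simp: Ya Alg_hom)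
    qed
  qed
  moreover have "e X \<in> hom D X (ob forget (ob M X, m X))"
    using assms by (simp add: hom_def)
  ultimately show ?thesis
    by (intro universal_arrowI free_obj assms)
qed

lemma forget_has_universal_arrows: "has_universal_arrows alg D forget"
  unfolding has_universal_arrows_def using free_universal by blast

text \<open>
  Every algebra \<open>(X, a)\<close> is a quotient of free algebras, \<open>MMX \<rightrightarrows> MX \<rightarrow> X\<close>.  Its universal property
  holds because the fork is split in the underlying category by \<open>e X\<close>: an algebra map \<open>f\<close> out of
  \<open>MX\<close> that coequalises the pair factors through \<open>a\<close> as \<open>f \<cdot> e X\<close>.
\<close>

lemma canonical_presentation:
  assumes "(X, a) \<in> Obj alg"
  defines "F1 \<equiv> (ob M (ob M X), m (ob M X))" and "F0 \<equiv> (ob M X, m X)"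
  shows "reflexive_pair alg (F1, F0, m X) (F1, F0, ar M a)"
    and "is_coequaliser alg (F1, F0, m X) (F1, F0, ar M a) (F0, (X, a), a)"
proof -
  have [simp]: "X \<in> Obj D" "a \<in> Arr D" "Dom D a = ob M X" "Cod D a = X"
    and ae: "a \<cdot>\<^bsub>D\<^esub> e X = Ide D X" and am: "a \<cdot>\<^bsub>D\<^esub> m X = a \<cdot>\<^bsub>D\<^esub> ar M a"
    using assms(1) by (auto simp: Alg_obj)
  have arr: "(F1, F0, m X) \<in> Arr alg" "(F1, F0, ar M a) \<in> Arr alg" "(F0, (X, a), a) \<in> Arr alg"
    "(F0, F1, ar M (e X)) \<in> Arr alg"
    using assoc[of X] assms(1) m_nat[of a "ob M X" X] m_nat[of "e X" X "ob M X"]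
    by (simp_all add: F1_def F0_def Alg_arr am)
  have homs: "(F1, F0, m X) \<in> hom alg F1 F0" "(F1, F0, ar M a) \<in> hom alg F1 F0"
    "(F0, (X, a), a) \<in> hom alg F0 (X, a)" "(F0, F1, ar M (e X)) \<in> hom alg F0 F1"
    using arr by (simp_all add: hom_def)
  have "ar M a \<cdot>\<^bsub>D\<^esub> ar M (e X) = Ide D (ob M X)"
    by (simp add: endo.ar_comp_arr[symmetric] ae)
  then show "reflexive_pair alg (F1, F0, m X) (F1, F0, ar M a)"
    unfolding reflexive_pair_def
    by (intro exI[of _ F1] exI[of _ F0] conjI bexI[of _ "(F0, F1, ar M (e X))"] homs)
      (simp_all add: F0_def unit_right)
  have "\<exists>!k. k \<in> hom alg (X, a) Z \<and> k \<cdot>\<^bsub>alg\<^esub> (F0, (X, a), a) = h"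
    if "h \<in> hom alg F0 Z" "h \<cdot>\<^bsub>alg\<^esub> (F1, F0, m X) = h \<cdot>\<^bsub>alg\<^esub> (F1, F0, ar M a)" for Z h
  proof -
    obtain Y b where Z: "Z = (Y, b)" by (cases Z)
    with that(1) obtain f where h: "h = (F0, Z, f)" and f: "(F0, Z, f) \<in> Arr alg"
      by (auto simp: F0_def Alg_hom)
    have [simp]: "Y \<in> Obj D" "b \<in> Arr D" "Dom D b = ob M Y" "Cod D b = Y"
      "f \<in> Arr D" "Dom D f = ob M X" "Cod D f = Y" and fm: "f \<cdot>\<^bsub>D\<^esub> m X = b \<cdot>\<^bsub>D\<^esub> ar M f"
      and Zo: "(Y, b) \<in> Obj alg"
      using f by (auto simp: F0_def Z Alg_arr Alg_obj)
    have fa: "f \<cdot>\<^bsub>D\<^esub> m X = f \<cdot>\<^bsub>D\<^esub> ar M a" using that(2) by (simp add: h)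
    have kf: "f \<cdot>\<^bsub>D\<^esub> e X \<cdot>\<^bsub>D\<^esub> a = f"
    proof -
      have "f \<cdot>\<^bsub>D\<^esub> e X \<cdot>\<^bsub>D\<^esub> a = f \<cdot>\<^bsub>D\<^esub> ar M a \<cdot>\<^bsub>D\<^esub> e (ob M X)"
        by (simp add: e_nat[of a "ob M X" X])
      also have "\<dots> = f \<cdot>\<^bsub>D\<^esub> (m X \<cdot>\<^bsub>D\<^esub> e (ob M X))" by (simp only: fa[symmetric]) simp
      finally show ?thesis by (simp add: unit_left)
    qed
    have "b \<cdot>\<^bsub>D\<^esub> ar M (f \<cdot>\<^bsub>D\<^esub> e X) = f \<cdot>\<^bsub>D\<^esub> (m X \<cdot>\<^bsub>D\<^esub> ar M (e X))"
      using endo.source.comp_cong_tail[OF fm, of "ar M (e X)"] by (simp add: endo.ar_comp_arr)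
    then have k: "((X, a), Z, f \<cdot>\<^bsub>D\<^esub> e X) \<in> Arr alg"
      using assms(1) Zo kf by (simp add: Z Alg_arr unit_right)
    have uniq: "g = f \<cdot>\<^bsub>D\<^esub> e X" if "((X, a), Z, g) \<in> Arr alg" "g \<cdot>\<^bsub>D\<^esub> a = f" for g
    proof -
      have [simp]: "g \<in> Arr D" "Dom D g = X" using that(1) by (auto simp: Z Alg_arr)
      have "g \<cdot>\<^bsub>D\<^esub> a \<cdot>\<^bsub>D\<^esub> e X = g" by (simp add: ae)
      then show ?thesis by (simp only: that(2))
    qed
    show ?thesis
    proof (rule ex1I[of _ "((X, a), Z, f \<cdot>\<^bsub>D\<^esub> e X)"])
      show "((X, a), Z, f \<cdot>\<^bsub>D\<^esub> e X) \<in> hom alg (X, a) Z \<and> ((X, a), Z, f \<cdot>\<^bsub>D\<^esub> e X) \<cdot>\<^bsub>alg\<^esub> (F0, (X, a), a) = h"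
        using k kf by (simp add: Z h Alg_hom)
      show "G = ((X, a), Z, f \<cdot>\<^bsub>D\<^esub> e X)"
        if "G \<in> hom alg (X, a) Z \<and> G \<cdot>\<^bsub>alg\<^esub> (F0, (X, a), a) = h" for G
        using that uniq[of "snd (snd G)"] by (auto simp: Z h Alg_hom)
    qed
  qed
  then show "is_coequaliser alg (F1, F0, m X) (F1, F0, ar M a) (F0, (X, a), a)"
    by (intro is_coequaliserI[of _ _ F1 F0 _ _ "(X, a)"] homs) (simp_all add: am)
qed

text \<open>
  Dubuc's adjoint triangle: a functor into algebras has a left adjoint as soon as its composite with
  the forgetful functor has one and the source has reflexive coequalisers.  Algebra maps
  \<open>MX \<rightarrow> G Y\<close> are arrows from \<open>X\<close> to the underlying object of \<open>G Y\<close>, so the hypothesis on the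
  composite provides universal arrows at all free algebras; the canonical presentation extends them
  to all algebras.
\<close>

theorem adjoint_triangle:
  assumes G: "is_functor A alg G" and A: "has_reflexive_coequalisers A"
    and univ: "has_universal_arrows A D (comp_funct forget G)"
  shows "has_universal_arrows A alg G"
proof -
  interpret G: is_functor A alg G by fact
  have UG: "is_functor A D (comp_funct forget G)"
    by (rule functor_comp[OF G forget_functor])
  have free: "\<exists>L u. universal_arrow A alg G (ob M X, m X) L u" if X: "X \<in> Obj D" for X
  proof -
    note e = free_universal[OF X]
    obtain L v where v: "universal_arrow A D (comp_funct forget G) X L v"
      using univ X by (auto simp: has_universal_arrows_def)
    have L: "L \<in> Obj A" and vh: "v \<in> hom D X (ob forget (ob G L))"
      using universal_arrowD[OF v] by (auto simp: comp_funct_def)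
    obtain u where u: "u \<in> hom alg (ob M X, m X) (ob G L)" "ar forget u \<cdot>\<^bsub>D\<^esub> e X = v"
      using universal_arrow_ex1[OF e vh G.ob_obj[OF L]] by blast
    \<comment> \<open>Precomposition with \<open>e X\<close> turns transposition along \<open>u\<close> into transposition along \<open>v\<close>.\<close>
    have *: "ar G k \<cdot>\<^bsub>alg\<^esub> u = h \<longleftrightarrow> ar (comp_funct forget G) k \<cdot>\<^bsub>D\<^esub> v = ar forget h \<cdot>\<^bsub>D\<^esub> e X"
      if k: "k \<in> hom A L Y" and h: "h \<in> hom alg (ob M X, m X) (ob G Y)" for k h Y
    proof -
      have Gk: "ar G k \<in> hom alg (ob G L) (ob G Y)" using k by (rule G.ar_hom)
      have "ar (comp_funct forget G) k \<cdot>\<^bsub>D\<^esub> v = ar forget (ar G k) \<cdot>\<^bsub>D\<^esub> (ar forget u \<cdot>\<^bsub>D\<^esub> e X)"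
        by (simp add: comp_funct_def u)
      also have "\<dots> = ar forget (ar G k) \<cdot>\<^bsub>D\<^esub> ar forget u \<cdot>\<^bsub>D\<^esub> e X"
        using is_functor.ar_hom[OF forget_functor Gk] is_functor.ar_hom[OF forget_functor u(1)] X
        by (simp add: hom_def)
      also have "\<dots> = ar forget (ar G k \<cdot>\<^bsub>alg\<^esub> u) \<cdot>\<^bsub>D\<^esub> e X"
        using is_functor.ar_comp[OF forget_functor u(1) Gk] by simp
      finally have "ar (comp_funct forget G) k \<cdot>\<^bsub>D\<^esub> v = ar forget (ar G k \<cdot>\<^bsub>alg\<^esub> u) \<cdot>\<^bsub>D\<^esub> e X" .
      moreover have "ar G k \<cdot>\<^bsub>alg\<^esub> u \<in> hom alg (ob M X, m X) (ob G Y)"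
        using u(1) Gk by (rule G.target.comp_hom)
      ultimately show ?thesis
        using universal_arrow_eqI[OF e forget_functor, of "ar G k \<cdot>\<^bsub>alg\<^esub> u" "ob G Y" h] h by metis
    qed
    have "\<exists>!k. k \<in> hom A L Y \<and> ar G k \<cdot>\<^bsub>alg\<^esub> u = h"
      if Y: "Y \<in> Obj A" and h: "h \<in> hom alg (ob M X, m X) (ob G Y)" for Y h
    proof -
      have "ar forget h \<cdot>\<^bsub>D\<^esub> e X \<in> hom D X (ob (comp_funct forget G) Y)"
        using is_functor.ar_hom[OF forget_functor h] X by (simp add: hom_def comp_funct_def)
      then have "\<exists>!k. k \<in> hom A L Y \<and> ar (comp_funct forget G) k \<cdot>\<^bsub>D\<^esub> v = ar forget h \<cdot>\<^bsub>D\<^esub> e X"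
        using universal_arrow_ex1[OF v] Y by blast
      then obtain k where k: "k \<in> hom A L Y" "ar (comp_funct forget G) k \<cdot>\<^bsub>D\<^esub> v = ar forget h \<cdot>\<^bsub>D\<^esub> e X"
        by blast
      show ?thesis
      proof (rule ex1I[of _ k])
        show "k \<in> hom A L Y \<and> ar G k \<cdot>\<^bsub>alg\<^esub> u = h" using k *[OF k(1) h] by simp
        show "k' = k" if "k' \<in> hom A L Y \<and> ar G k' \<cdot>\<^bsub>alg\<^esub> u = h" for k'
          using that *[of k', OF _ h] k by - (rule universal_arrow_eqI[OF v UG _ k(1)], simp_all)
      qed
    qed
    then have "universal_arrow A alg G (ob M X, m X) L u" by (intro universal_arrowI L u(1))
    then show ?thesis by blast
  qed
  show ?thesis
    unfolding has_universal_arrows_def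
  proof
    fix B assume B: "B \<in> Obj alg"
    obtain X a where Xa: "B = (X, a)" by (cases B)
    have X: "X \<in> Obj D" using B by (simp add: Xa Alg_obj)
    note pres = canonical_presentation[OF B[unfolded Xa]]
    obtain L1 u1 L0 u0 where "universal_arrow A alg G (ob M (ob M X), m (ob M X)) L1 u1"
      "universal_arrow A alg G (ob M X, m X) L0 u0"
      using free[OF X] free[OF endo.ob_obj[OF X]] by blast
    then show "\<exists>L u. universal_arrow A alg G B L u"
      using universal_arrow_coequaliser[OF G A pres] by (simp add: Xa)
  qed
qed

text \<open>
  The coequaliser is formed on underlying objects.  Preservation by \<open>M\<close> is used twice: on the pair
  itself, to induce an action on the quotient, and on its image under \<open>M\<close>, which is again
  reflexive, to know that \<open>M M q\<close> is epi and hence that this action is associative.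
\<close>

theorem Alg_has_reflexive_coequalisers:
  assumes D: "has_reflexive_coequalisers D" and M: "preserves_reflexive_coequalisers D D M"
  shows "has_reflexive_coequalisers alg"
  unfolding has_reflexive_coequalisers_def
proof (intro allI impI)
  fix F G assume "reflexive_pair alg F G"
  then obtain A B S where FGS: "F \<in> hom alg A B" "G \<in> hom alg A B" "S \<in> hom alg B A"
    "F \<cdot>\<^bsub>alg\<^esub> S = Ide alg B" "G \<cdot>\<^bsub>alg\<^esub> S = Ide alg B"
    unfolding reflexive_pair_def by blast
  obtain X a Y b where AB: "A = (X, a)" "B = (Y, b)" by (cases A; cases B)
  obtain f g s where F: "F = (A, B, f)" and G: "G = (A, B, g)" and S: "S = (B, A, s)"
    and arr: "(A, B, f) \<in> Arr alg" "(A, B, g) \<in> Arr alg" "(B, A, s) \<in> Arr alg"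
    using FGS(1-3) by (auto simp: AB Alg_hom)
  have obj: "(X, a) \<in> Obj alg" "(Y, b) \<in> Obj alg" using arr by (simp_all add: AB Alg_arr)
  have [simp]: "X \<in> Obj D" "Y \<in> Obj D" "a \<in> Arr D" "Dom D a = ob M X" "Cod D a = X"
    "b \<in> Arr D" "Dom D b = ob M Y" "Cod D b = Y"
    using obj by (auto simp: Alg_obj)
  have [simp]: "f \<in> Arr D" "Dom D f = X" "Cod D f = Y" "g \<in> Arr D" "Dom D g = X" "Cod D g = Y"
    "s \<in> Arr D" "Dom D s = Y" "Cod D s = X"
    using arr by (auto simp: AB Alg_arr)
  have fa: "f \<cdot>\<^bsub>D\<^esub> a = b \<cdot>\<^bsub>D\<^esub> ar M f" and ga: "g \<cdot>\<^bsub>D\<^esub> a = b \<cdot>\<^bsub>D\<^esub> ar M g"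
    using arr by (auto simp: AB Alg_arr)
  have be: "b \<cdot>\<^bsub>D\<^esub> e Y = Ide D Y" and bm: "b \<cdot>\<^bsub>D\<^esub> m Y = b \<cdot>\<^bsub>D\<^esub> ar M b"
    using obj by (auto simp: Alg_obj)
  have fs: "f \<cdot>\<^bsub>D\<^esub> s = Ide D Y" "g \<cdot>\<^bsub>D\<^esub> s = Ide D Y" using FGS(4,5) by (simp_all add: F G S AB)
  have refl: "reflexive_pair D f g"
    unfolding reflexive_pair_def
    by (intro exI[of _ X] exI[of _ Y] conjI bexI[of _ s]) (simp_all add: fs hom_def)
  have Mrefl: "reflexive_pair D (ar M f) (ar M g)"
    unfolding reflexive_pair_def
    by (intro exI[of _ "ob M X"] exI[of _ "ob M Y"] conjI bexI[of _ "ar M s"])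
      (simp_all add: endo.ar_comp_arr[symmetric] fs hom_def)
  obtain q where q: "is_coequaliser D f g q"
    using D refl by (auto simp: has_reflexive_coequalisers_def)
  have Mq: "is_coequaliser D (ar M f) (ar M g) (ar M q)"
    using M refl q unfolding preserves_reflexive_coequalisers_def by blast
  have MMq: "is_coequaliser D (ar M (ar M f)) (ar M (ar M g)) (ar M (ar M q))"
    using M Mrefl Mq unfolding preserves_reflexive_coequalisers_def by blast
  have fXY: "f \<in> hom D X Y" "ar M f \<in> hom D (ob M X) (ob M Y)" by (simp_all add: hom_def)
  obtain E where qE: "q \<in> hom D Y E" and qfg: "q \<cdot>\<^bsub>D\<^esub> f = q \<cdot>\<^bsub>D\<^esub> g"
    and q_univ: "\<And>Z h. \<lbrakk>h \<in> hom D Y Z; h \<cdot>\<^bsub>D\<^esub> f = h \<cdot>\<^bsub>D\<^esub> g\<rbrakk> \<Longrightarrow> \<exists>!k. k \<in> hom D E Z \<and> k \<cdot>\<^bsub>D\<^esub> q = h"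
    by (rule is_coequaliser_hom[OF q fXY(1)]) (rule that)
  have [simp]: "q \<in> Arr D" "Dom D q = Y" "Cod D q = E" "E \<in> Obj D"
    using qE endo.source.hom_obj[OF qE] by (auto simp: hom_def)
  obtain E' where "ar M q \<in> hom D (ob M Y) E'"
    and Mq_univ: "\<And>Z h. \<lbrakk>h \<in> hom D (ob M Y) Z; h \<cdot>\<^bsub>D\<^esub> ar M f = h \<cdot>\<^bsub>D\<^esub> ar M g\<rbrakk> \<Longrightarrow>
      \<exists>!k. k \<in> hom D E' Z \<and> k \<cdot>\<^bsub>D\<^esub> ar M q = h"
    by (rule is_coequaliser_hom[OF Mq fXY(2)]) (rule that)
  then have E': "E' = ob M E" by (simp add: hom_def)
  \<comment> \<open>The action of \<open>M\<close> on \<open>E\<close> is induced by \<open>q \<cdot> b\<close>.\<close>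
  have "(q \<cdot>\<^bsub>D\<^esub> b) \<cdot>\<^bsub>D\<^esub> ar M f = (q \<cdot>\<^bsub>D\<^esub> b) \<cdot>\<^bsub>D\<^esub> ar M g"
    using endo.source.comp_cong_tail[OF qfg, of a] by (simp add: fa[symmetric] ga[symmetric])
  then obtain c where c [simp]: "c \<in> Arr D" "Dom D c = ob M E" "Cod D c = E" and cq: "c \<cdot>\<^bsub>D\<^esub> ar M q = q \<cdot>\<^bsub>D\<^esub> b"
    using Mq_univ[of "q \<cdot>\<^bsub>D\<^esub> b" E] by (auto simp: hom_def E')
  note cq_tail = endo.source.comp_cong_tail[OF cq]
  have "c \<cdot>\<^bsub>D\<^esub> e E \<cdot>\<^bsub>D\<^esub> q = Ide D E \<cdot>\<^bsub>D\<^esub> q"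
    by (simp add: e_nat[of q Y E] cq_tail be)
  then have ce: "c \<cdot>\<^bsub>D\<^esub> e E = Ide D E"
    by - (rule endo.source.coequaliser_epi[OF q], simp_all)
  have "c \<cdot>\<^bsub>D\<^esub> m E \<cdot>\<^bsub>D\<^esub> ar M (ar M q) = c \<cdot>\<^bsub>D\<^esub> ar M c \<cdot>\<^bsub>D\<^esub> ar M (ar M q)"
    by (simp add: m_nat[of q Y E] cq_tail bm endo.ar_comp_arr[symmetric] cq)
      (simp add: endo.ar_comp_arr cq_tail)
  then have cm: "c \<cdot>\<^bsub>D\<^esub> m E = c \<cdot>\<^bsub>D\<^esub> ar M c"
    by - (rule endo.source.coequaliser_epi[OF MMq], simp_all)
  have c_obj: "(E, c) \<in> Obj alg" using ce cm by (simp add: Alg_obj)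
  have q_arr: "(B, (E, c), q) \<in> Arr alg" using obj c_obj cq by (simp add: AB Alg_arr)
  have "\<exists>!k. k \<in> hom alg (E, c) Z \<and> k \<cdot>\<^bsub>alg\<^esub> (B, (E, c), q) = H"
    if HZ: "H \<in> hom alg B Z" "H \<cdot>\<^bsub>alg\<^esub> F = H \<cdot>\<^bsub>alg\<^esub> G" for Z H
  proof -
    obtain W z where Z: "Z = (W, z)" by (cases Z)
    obtain h where H: "H = (B, Z, h)" and h: "(B, Z, h) \<in> Arr alg"
      using HZ(1) by (auto simp: AB Z Alg_hom)
    have [simp]: "W \<in> Obj D" "z \<in> Arr D" "Dom D z = ob M W" "Cod D z = W"
      "h \<in> Arr D" "Dom D h = Y" "Cod D h = W" and Zo: "(W, z) \<in> Obj alg"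
      and hb: "h \<cdot>\<^bsub>D\<^esub> b = z \<cdot>\<^bsub>D\<^esub> ar M h"
      using h by (auto simp: AB Z Alg_arr Alg_obj)
    have "h \<cdot>\<^bsub>D\<^esub> f = h \<cdot>\<^bsub>D\<^esub> g" using HZ(2) by (simp add: F G H)
    then have ex: "\<exists>!k. k \<in> hom D E W \<and> k \<cdot>\<^bsub>D\<^esub> q = h"
      by (intro q_univ) (simp_all add: hom_def)
    then obtain k where k: "k \<in> hom D E W" "k \<cdot>\<^bsub>D\<^esub> q = h" by blast
    have [simp]: "k \<in> Arr D" "Dom D k = E" "Cod D k = W" using k by (auto simp: hom_def)
    have "k \<cdot>\<^bsub>D\<^esub> c \<cdot>\<^bsub>D\<^esub> ar M q = z \<cdot>\<^bsub>D\<^esub> ar M k \<cdot>\<^bsub>D\<^esub> ar M q"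
      using endo.source.comp_cong_tail[OF k(2), of b] hb
      by (simp add: cq endo.ar_comp_arr[symmetric] k)
    then have kc: "k \<cdot>\<^bsub>D\<^esub> c = z \<cdot>\<^bsub>D\<^esub> ar M k"
      by - (rule endo.source.coequaliser_epi[OF Mq], simp_all)
    show ?thesis
    proof (rule ex1I[of _ "((E, c), Z, k)"])
      show "((E, c), Z, k) \<in> hom alg (E, c) Z \<and> ((E, c), Z, k) \<cdot>\<^bsub>alg\<^esub> (B, (E, c), q) = H"
        using Zo c_obj kc k by (simp add: Z H Alg_hom Alg_arr)
    next
      fix K assume K: "K \<in> hom alg (E, c) Z \<and> K \<cdot>\<^bsub>alg\<^esub> (B, (E, c), q) = H"
      then obtain k' where k': "K = ((E, c), Z, k')" "K \<in> Arr alg" by (auto simp: Z Alg_hom)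
      then have "k' \<in> hom D E W" "k' \<cdot>\<^bsub>D\<^esub> q = h" using K by (auto simp: Z H Alg_arr hom_def)
      with ex k have "k' = k" by blast
      with k' show "K = ((E, c), Z, k)" by simp
    qed
  qed
  moreover have "(B, (E, c), q) \<cdot>\<^bsub>alg\<^esub> F = (B, (E, c), q) \<cdot>\<^bsub>alg\<^esub> G" by (simp add: F G qfg)
  moreover have "(B, (E, c), q) \<in> hom alg B (E, c)" using q_arr by (simp add: hom_def)
  ultimately have "is_coequaliser alg F G (B, (E, c), q)"
    using FGS(1,2) by (intro is_coequaliserI)
  then show "\<exists>q. is_coequaliser alg F G q" by blast
qed

end

section \<open>Coalgebras as algebras in the opposite category\<close>

text \<open>
  The opposite of the category of \<open>Q\<close>-coalgebras is the category of algebras over \<open>Q\<close>, seen as a monad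
  on the opposite category.  The two differ only in their encoding of morphisms: a triple lists its
  source first, and passing to the opposite exchanges source and target.  Renaming the arrows of a
  category along an involution accounts for this.
\<close>

definition relabel :: "('a \<Rightarrow> 'a) \<Rightarrow> ('o, 'a) cat \<Rightarrow> ('o, 'a) cat" where
  "relabel \<sigma> A = \<lparr>Obj = Obj A, Arr = \<sigma> -` Arr A, Dom = (\<lambda>f. Dom A (\<sigma> f)), Cod = (\<lambda>f. Cod A (\<sigma> f)),
     Ide = (\<lambda>X. \<sigma> (Ide A X)), Comp = (\<lambda>g f. \<sigma> (\<sigma> g \<cdot>\<^bsub>A\<^esub> \<sigma> f))\<rparr>"

locale relabelling = category A for A :: "('o, 'a) cat" and \<sigma> :: "'a \<Rightarrow> 'a" +
  assumes invol [simp]: "\<sigma> (\<sigma> f) = f"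
begin

abbreviation "A' \<equiv> relabel \<sigma> A"

lemma relabel_simps [simp]:
  "Obj A' = Obj A" "f \<in> Arr A' \<longleftrightarrow> \<sigma> f \<in> Arr A" "Dom A' f = Dom A (\<sigma> f)" "Cod A' f = Cod A (\<sigma> f)"
  "Ide A' X = \<sigma> (Ide A X)" "g \<cdot>\<^bsub>A'\<^esub> f = \<sigma> (\<sigma> g \<cdot>\<^bsub>A\<^esub> \<sigma> f)"
  by (simp_all add: relabel_def)

lemma relabel_hom: "f \<in> hom A' X Y \<longleftrightarrow> \<sigma> f \<in> hom A X Y"
  by (simp add: hom_def)

lemma relabel_eq: "\<sigma> f = g \<longleftrightarrow> f = \<sigma> g"
  by auto

lemma category_relabel: "category A'"
  by unfold_locales (auto simp: dom_obj cod_obj hom_def)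

lemma relabel_ex1: "(\<exists>!k. k \<in> hom A X Y \<and> P k) \<Longrightarrow> (\<exists>!k. k \<in> hom A' X Y \<and> P (\<sigma> k))"
  unfolding relabel_hom by (metis invol)

lemma relabel_coequalisers:
  assumes "has_reflexive_coequalisers A" shows "has_reflexive_coequalisers A'"
  unfolding has_reflexive_coequalisers_def
proof (intro allI impI)
  fix f g assume "reflexive_pair A' f g"
  then obtain X Y s where fgs: "f \<in> hom A' X Y" "g \<in> hom A' X Y" "s \<in> hom A' Y X"
    "f \<cdot>\<^bsub>A'\<^esub> s = Ide A' Y" "g \<cdot>\<^bsub>A'\<^esub> s = Ide A' Y"
    unfolding reflexive_pair_def by blast
  have fg: "\<sigma> f \<in> hom A X Y" "\<sigma> g \<in> hom A X Y" "\<sigma> s \<in> hom A Y X"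
    using fgs(1-3) by (simp_all add: relabel_hom)
  have sect: "\<sigma> f \<cdot>\<^bsub>A\<^esub> \<sigma> s = Ide A Y" "\<sigma> g \<cdot>\<^bsub>A\<^esub> \<sigma> s = Ide A Y"
    using fgs(4,5) by (simp_all add: relabel_eq)
  have "reflexive_pair A (\<sigma> f) (\<sigma> g)"
    unfolding reflexive_pair_def using fg sect by blast
  then obtain q where q: "is_coequaliser A (\<sigma> f) (\<sigma> g) q"
    using assms by (auto simp: has_reflexive_coequalisers_def)
  obtain E where E: "q \<in> hom A Y E" "q \<cdot>\<^bsub>A\<^esub> \<sigma> f = q \<cdot>\<^bsub>A\<^esub> \<sigma> g"
    "\<And>Z h. \<lbrakk>h \<in> hom A Y Z; h \<cdot>\<^bsub>A\<^esub> \<sigma> f = h \<cdot>\<^bsub>A\<^esub> \<sigma> g\<rbrakk> \<Longrightarrow> \<exists>!k. k \<in> hom A E Z \<and> k \<cdot>\<^bsub>A\<^esub> q = h"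
    by (rule is_coequaliser_hom[OF q fg(1)]) (rule that)
  have "is_coequaliser A' f g (\<sigma> q)"
  proof (rule is_coequaliserI[OF fgs(1,2)])
    show "\<sigma> q \<in> hom A' Y E" using E(1) by (simp add: relabel_hom)
    show "\<sigma> q \<cdot>\<^bsub>A'\<^esub> f = \<sigma> q \<cdot>\<^bsub>A'\<^esub> g" using E(2) by simp
    show "\<exists>!k. k \<in> hom A' E Z \<and> k \<cdot>\<^bsub>A'\<^esub> \<sigma> q = h"
      if h: "h \<in> hom A' Y Z" and hfg: "h \<cdot>\<^bsub>A'\<^esub> f = h \<cdot>\<^bsub>A'\<^esub> g" for Z h
    proof -
      have "\<sigma> h \<cdot>\<^bsub>A\<^esub> \<sigma> f = \<sigma> h \<cdot>\<^bsub>A\<^esub> \<sigma> g" using hfg by (simp add: relabel_eq)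
      then have "\<exists>!k. k \<in> hom A E Z \<and> k \<cdot>\<^bsub>A\<^esub> q = \<sigma> h"
        using h by (intro E(3)) (simp_all add: relabel_hom)
      from relabel_ex1[OF this] show ?thesis by (simp add: relabel_eq)
    qed
  qed
  then show "\<exists>q. is_coequaliser A' f g q" by blast
qed

lemma relabel_functor:
  assumes "is_functor A B F" "\<And>f. ar F (\<sigma> f) = ar F f"
  shows "is_functor A' B F"
proof -
  interpret F: is_functor A B F by fact
  interpret A': category A' by (rule category_relabel)
  show ?thesis
  proof
    show "f \<in> hom A' X Y \<Longrightarrow> ar F f \<in> hom B (ob F X) (ob F Y)" for f X Y
      using F.ar_hom[of "\<sigma> f"] by (simp add: relabel_hom assms(2))
    show "f \<in> hom A' X Y \<Longrightarrow> g \<in> hom A' Y Z \<Longrightarrow> ar F (g \<cdot>\<^bsub>A'\<^esub> f) = ar F g \<cdot>\<^bsub>B\<^esub> ar F f" for f g X Y Z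
      using F.ar_comp[of "\<sigma> f" X Y "\<sigma> g" Z] by (simp add: relabel_hom assms(2))
  qed (simp_all add: assms(2))
qed

lemma relabel_universal_arrows:
  assumes "has_universal_arrows A B F" "\<And>f. ar F (\<sigma> f) = ar F f"
  shows "has_universal_arrows A' B F"
  unfolding has_universal_arrows_def
proof
  fix X assume "X \<in> Obj B"
  then obtain L u where u: "universal_arrow A B F X L u"
    using assms(1) by (auto simp: has_universal_arrows_def)
  have "universal_arrow A' B F X L u"
  proof (rule universal_arrowI)
    show "\<exists>!g. g \<in> hom A' L Y \<and> ar F g \<cdot>\<^bsub>B\<^esub> u = f" if "Y \<in> Obj A'" "f \<in> hom B X (ob F Y)" for Y f
      using relabel_ex1[OF universal_arrow_ex1[OF u that(2)]] that(1) by (simp add: assms(2))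
  qed (use universal_arrowD[OF u] in simp_all)
  then show "\<exists>L u. universal_arrow A' B F X L u" by blast
qed

end

lemma is_coequaliser_op: "is_coequaliser (op_cat C) f g e \<longleftrightarrow> is_equaliser C f g e"
  unfolding is_coequaliser_def is_equaliser_def by simp blast

lemma reflexive_pair_op: "reflexive_pair (op_cat C) f g \<longleftrightarrow> coreflexive_pair C f g"
  unfolding reflexive_pair_def coreflexive_pair_def by simp blast

lemma Coalg_simps [simp]:
  "Dom (Coalg C Q w n) (A, B, f) = A" "Cod (Coalg C Q w n) (A, B, f) = B"
  "Ide (Coalg C Q w n) A = (A, A, Ide C (fst A))"
  "(B, B', g) \<cdot>\<^bsub>Coalg C Q w n\<^esub> (A, A', f) = (A, B', g \<cdot>\<^bsub>C\<^esub> f)"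
  by (simp_all add: Coalg_def Let_def)

lemma Coalg_obj:
  "(V, c) \<in> Obj (Coalg C Q w n) \<longleftrightarrow> V \<in> Obj C \<and> c \<in> Arr C \<and> Dom C c = V \<and> Cod C c = ob Q V \<and>
    n V \<cdot>\<^bsub>C\<^esub> c = Ide C V \<and> w V \<cdot>\<^bsub>C\<^esub> c = ar Q c \<cdot>\<^bsub>C\<^esub> c"
  by (auto simp: Coalg_def Let_def hom_def)

lemma Coalg_arr:
  "((V, c), (W, d), f) \<in> Arr (Coalg C Q w n) \<longleftrightarrow>
    (V, c) \<in> Obj (Coalg C Q w n) \<and> (W, d) \<in> Obj (Coalg C Q w n) \<and>
    f \<in> Arr C \<and> Dom C f = V \<and> Cod C f = W \<and> d \<cdot>\<^bsub>C\<^esub> f = ar Q f \<cdot>\<^bsub>C\<^esub> c"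
  by (auto simp: Coalg_def Let_def hom_def)

lemma Coalg_hom:
  "F \<in> hom (Coalg C Q w n) (V, c) (W, d) \<longleftrightarrow> (\<exists>f. F = ((V, c), (W, d), f) \<and> F \<in> Arr (Coalg C Q w n))"
  by (cases F) (auto simp: hom_def)

definition swap_ends :: "('o, 'a) str_arr \<Rightarrow> ('o, 'a) str_arr" where
  "swap_ends F = (fst (snd F), fst F, snd (snd F))"

lemma swap_ends_simps [simp]: "swap_ends (A, B, f) = (B, A, f)"
  by (simp add: swap_ends_def)

lemma swap_ends_invol: "swap_ends (swap_ends F) = F"
  by (simp add: swap_ends_def)

lemma forget_swap_ends: "ar forget (swap_ends F) = ar forget F"
  by (cases F) simp

lemma op_Coalg: "op_cat (Coalg C Q w n) = relabel swap_ends (Alg (op_cat C) Q w n)"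
  (is "?L = ?R")
proof -
  have "Obj ?L = Obj ?R"
    by (auto simp: relabel_def Alg_obj Coalg_obj)
  moreover have "Arr ?L = Arr ?R"
    by (auto simp: relabel_def Alg_obj Coalg_obj Alg_arr Coalg_arr)
  moreover have "Dom ?L = Dom ?R" "Cod ?L = Cod ?R" "Ide ?L = Ide ?R" "Comp ?L = Comp ?R"
    by (auto simp: relabel_def fun_eq_iff)
  ultimately show ?thesis by simp
qed

context comonad
begin

abbreviation "coalg \<equiv> Coalg C Q w n"

lemma monad_op: "monad (op_cat C) Q w n"
proof (intro monad.intro monad_axioms.intro)
  interpret w: nat_trans C C Q "comp_funct Q Q" w by (rule comult)
  interpret n: nat_trans C C Q id_funct n by (rule counit)
  show Q: "is_functor (op_cat C) (op_cat C) Q" by (rule endo.functor_op)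
  show "nat_trans (op_cat C) (op_cat C) (comp_funct Q Q) Q w"
    by (intro nat_trans.intro nat_trans_axioms.intro w.G.functor_op Q)
      (auto intro: w.component_hom w.natural[symmetric])
  show "nat_trans (op_cat C) (op_cat C) id_funct Q n"
    by (intro nat_trans.intro nat_trans_axioms.intro n.G.functor_op Q)
      (auto intro: n.component_hom n.natural[symmetric])
qed (simp_all add: coassoc counit_left counit_right)

lemma op_coalg_relabelling: "relabelling (Alg (op_cat C) Q w n) swap_ends"
  by (intro relabelling.intro relabelling_axioms.intro monad.category_Alg monad_op swap_ends_invol)

lemma category_Coalg: "category coalg"
  using category_op[OF relabelling.category_relabel[OF op_coalg_relabelling]]
  by (simp flip: op_Coalg)

lemma forget_coalg_functor: "is_functor (op_cat coalg) (op_cat C) forget"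
  unfolding op_Coalg
  by (rule relabelling.relabel_functor[OF op_coalg_relabelling monad.forget_functor[OF monad_op] forget_swap_ends])

lemma forget_coalg_universal_arrows: "has_universal_arrows (op_cat coalg) (op_cat C) forget"
  unfolding op_Coalg
  by (rule relabelling.relabel_universal_arrows
      [OF op_coalg_relabelling monad.forget_has_universal_arrows[OF monad_op] forget_swap_ends])

lemma op_Coalg_has_reflexive_coequalisers:
  assumes "has_coreflexive_equalisers C" "preserves_coreflexive_equalisers C C Q"
  shows "has_reflexive_coequalisers (op_cat coalg)"
  unfolding op_Coalg
  using assms
  by (intro relabelling.relabel_coequalisers[OF op_coalg_relabelling]
      monad.Alg_has_reflexive_coequalisers[OF monad_op])
    (simp_all add: has_reflexive_coequalisers_def has_coreflexive_equalisers_def reflexive_pair_op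
      is_coequaliser_op preserves_reflexive_coequalisers_def preserves_coreflexive_equalisers_def)

end

section \<open>The monoidal category of coalgebras over a Hopf comonad\<close>

context monoidal_category
begin

lemma tensor_bifunctor: "bifunctor C C C (tensor S)"
  by (intro bifunctor.intro tensor_functor category_axioms)

lemmas tensor_simps [simp] =
  bifunctor.bi_obj[OF tensor_bifunctor] bifunctor.bi_arr[OF tensor_bifunctor]
  bifunctor.bi_dom[OF tensor_bifunctor] bifunctor.bi_cod[OF tensor_bifunctor]
  bifunctor.bi_id[OF tensor_bifunctor]

lemmas tensor_comp = bifunctor.bi_comp[OF tensor_bifunctor]
lemmas tensor_comp_tail = bifunctor.bi_comp_tail[OF tensor_bifunctor]

lemma assoc_arrs [simp]:
  assumes "X \<in> Obj C" "Y \<in> Obj C" "Z \<in> Obj C"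
  shows "assoc S X Y Z \<in> Arr C" "Dom C (assoc S X Y Z) = (X \<otimes>\<^bsub>S\<^esub> Y) \<otimes>\<^bsub>S\<^esub> Z"
    "Cod C (assoc S X Y Z) = X \<otimes>\<^bsub>S\<^esub> (Y \<otimes>\<^bsub>S\<^esub> Z)"
  using assoc_hom[OF assms] by (auto simp: hom_def)

lemma unitor_arrs [simp]:
  assumes "X \<in> Obj C"
  shows "lunit S X \<in> Arr C" "Dom C (lunit S X) = unit S \<otimes>\<^bsub>S\<^esub> X" "Cod C (lunit S X) = X"
    "runit S X \<in> Arr C" "Dom C (runit S X) = X \<otimes>\<^bsub>S\<^esub> unit S" "Cod C (runit S X) = X"
  using lunit_hom[OF assms] runit_hom[OF assms] by (auto simp: hom_def)

declare unit_obj [simp]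

end

text \<open>
  The forgetful functor reflects isomorphisms, so the structural isomorphisms of \<open>C\<close> stay invertible
  in coalgebras once they are known to be coalgebra morphisms.
\<close>

lemma (in comonad) Coalg_iso:
  assumes f: "((V, c), (W, d), f) \<in> Arr coalg" and iso: "is_iso C f"
  shows "is_iso coalg ((V, c), (W, d), f)"
proof -
  have [simp]: "f \<in> Arr C" "Dom C f = V" "Cod C f = W" "c \<in> Arr C" "Dom C c = V" "Cod C c = ob Q V"
    "d \<in> Arr C" "Dom C d = W" "Cod C d = ob Q W" "V \<in> Obj C" "W \<in> Obj C"
    and df: "d \<cdot>\<^bsub>C\<^esub> f = ar Q f \<cdot>\<^bsub>C\<^esub> c" and obj: "(V, c) \<in> Obj coalg" "(W, d) \<in> Obj coalg"
    using f by (auto simp: Coalg_arr Coalg_obj)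
  obtain g where g [simp]: "g \<in> Arr C" "Dom C g = W" "Cod C g = V"
    and gf: "g \<cdot>\<^bsub>C\<^esub> f = Ide C V" and fg: "f \<cdot>\<^bsub>C\<^esub> g = Ide C W"
    using iso by (auto simp: is_iso_def is_inverse_def hom_def)
  have "c \<cdot>\<^bsub>C\<^esub> g = ar Q (g \<cdot>\<^bsub>C\<^esub> f) \<cdot>\<^bsub>C\<^esub> (c \<cdot>\<^bsub>C\<^esub> g)" by (simp add: gf)
  also have "\<dots> = ar Q g \<cdot>\<^bsub>C\<^esub> (d \<cdot>\<^bsub>C\<^esub> f \<cdot>\<^bsub>C\<^esub> g)"
    by (simp only: df) (simp add: endo.ar_comp_arr)
  also have "\<dots> = ar Q g \<cdot>\<^bsub>C\<^esub> d" by (simp add: fg)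
  finally have "((W, d), (V, c), g) \<in> Arr coalg" using obj by (simp add: Coalg_arr)
  then show ?thesis
    using f fg gf unfolding is_iso_def is_inverse_def
    by (intro exI[of _ "((W, d), (V, c), g)"]) (simp add: Coalg_hom)
qed

context hopf_comonad
begin

abbreviation "mcoalg \<equiv> Coalg_monoidal C S \<mu> \<eta>"

lemma mult_arrs [simp]:
  assumes "X \<in> Obj C" "Y \<in> Obj C"
  shows "\<mu> X Y \<in> Arr C" "Dom C (\<mu> X Y) = ob Q X \<otimes>\<^bsub>S\<^esub> ob Q Y" "Cod C (\<mu> X Y) = ob Q (X \<otimes>\<^bsub>S\<^esub> Y)"
  using mult_hom[OF assms] by (auto simp: hom_def)

lemma unit_arrs [simp]: "\<eta> \<in> Arr C" "Dom C \<eta> = unit S" "Cod C \<eta> = ob Q (unit S)"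
  using unit_hom by (auto simp: hom_def)

lemma comult_arrs [simp]:
  assumes "X \<in> Obj C"
  shows "w X \<in> Arr C" "Dom C (w X) = ob Q X" "Cod C (w X) = ob Q (ob Q X)"
    "n X \<in> Arr C" "Dom C (n X) = ob Q X" "Cod C (n X) = X"
  using nat_trans.component_hom[OF comult assms] nat_trans.component_hom[OF counit assms]
  by (auto simp: hom_def comp_funct_def id_funct_def)

lemma mult_nat:
  assumes "f \<in> Arr C" "g \<in> Arr C" "Dom C f = X" "Cod C f = X'" "Dom C g = Y" "Cod C g = Y'"
  shows "\<mu> X' Y' \<cdot>\<^bsub>C\<^esub> (ar Q f \<star>\<^bsub>S\<^esub> ar Q g) = ar Q (f \<star>\<^bsub>S\<^esub> g) \<cdot>\<^bsub>C\<^esub> \<mu> X Y"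
  using mult_natural[of f X X' g Y Y'] assms by (simp add: hom_def)

lemma comult_mult:
  "\<lbrakk>X \<in> Obj C; Y \<in> Obj C\<rbrakk> \<Longrightarrow> w (X \<otimes>\<^bsub>S\<^esub> Y) \<cdot>\<^bsub>C\<^esub> \<mu> X Y =
    (ar Q (\<mu> X Y) \<cdot>\<^bsub>C\<^esub> \<mu> (ob Q X) (ob Q Y)) \<cdot>\<^bsub>C\<^esub> (w X \<star>\<^bsub>S\<^esub> w Y)"
  by (rule monoidal_nat_trans.compat_mult[OF comult_monoidal])

lemma counit_mult:
  assumes "X \<in> Obj C" "Y \<in> Obj C" shows "n (X \<otimes>\<^bsub>S\<^esub> Y) \<cdot>\<^bsub>C\<^esub> \<mu> X Y = n X \<star>\<^bsub>S\<^esub> n Y"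
  using monoidal_nat_trans.compat_mult[OF counit_monoidal assms] assms by simp

text \<open>
  Compatibility of \<open>w\<close> and \<open>n\<close> with the lax structure of \<open>Q\<close> is what makes a tensor product of
  coactions a coaction.
\<close>

lemma tensor_obj:
  assumes "(V, c) \<in> Obj coalg" "(W, d) \<in> Obj coalg"
  shows "(V \<otimes>\<^bsub>S\<^esub> W, \<mu> V W \<cdot>\<^bsub>C\<^esub> (c \<star>\<^bsub>S\<^esub> d)) \<in> Obj coalg"
proof -
  have [simp]: "c \<in> Arr C" "Dom C c = V" "Cod C c = ob Q V" "V \<in> Obj C"
    "d \<in> Arr C" "Dom C d = W" "Cod C d = ob Q W" "W \<in> Obj C"
    and nc: "n V \<cdot>\<^bsub>C\<^esub> c = Ide C V" and nd: "n W \<cdot>\<^bsub>C\<^esub> d = Ide C W"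
    and wc: "w V \<cdot>\<^bsub>C\<^esub> c = ar Q c \<cdot>\<^bsub>C\<^esub> c" and wd: "w W \<cdot>\<^bsub>C\<^esub> d = ar Q d \<cdot>\<^bsub>C\<^esub> d"
    using assms by (auto simp: Coalg_obj)
  have "n (V \<otimes>\<^bsub>S\<^esub> W) \<cdot>\<^bsub>C\<^esub> (\<mu> V W \<cdot>\<^bsub>C\<^esub> (c \<star>\<^bsub>S\<^esub> d)) = Ide C (V \<otimes>\<^bsub>S\<^esub> W)"
    by (simp add: endo.source.comp_cong_tail[OF counit_mult] source.tensor_comp nc nd)
  moreover have "w (V \<otimes>\<^bsub>S\<^esub> W) \<cdot>\<^bsub>C\<^esub> (\<mu> V W \<cdot>\<^bsub>C\<^esub> (c \<star>\<^bsub>S\<^esub> d)) =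
      ar Q (\<mu> V W \<cdot>\<^bsub>C\<^esub> (c \<star>\<^bsub>S\<^esub> d)) \<cdot>\<^bsub>C\<^esub> (\<mu> V W \<cdot>\<^bsub>C\<^esub> (c \<star>\<^bsub>S\<^esub> d))"
  proof -
    have "w (V \<otimes>\<^bsub>S\<^esub> W) \<cdot>\<^bsub>C\<^esub> (\<mu> V W \<cdot>\<^bsub>C\<^esub> (c \<star>\<^bsub>S\<^esub> d)) =
        ar Q (\<mu> V W) \<cdot>\<^bsub>C\<^esub> (\<mu> (ob Q V) (ob Q W) \<cdot>\<^bsub>C\<^esub> ((ar Q c \<cdot>\<^bsub>C\<^esub> c) \<star>\<^bsub>S\<^esub> (ar Q d \<cdot>\<^bsub>C\<^esub> d)))"
      by (simp add: endo.source.comp_cong_tail[OF comult_mult] source.tensor_comp wc wd)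
    also have "\<dots> = ar Q (\<mu> V W) \<cdot>\<^bsub>C\<^esub> ((\<mu> (ob Q V) (ob Q W) \<cdot>\<^bsub>C\<^esub> (ar Q c \<star>\<^bsub>S\<^esub> ar Q d)) \<cdot>\<^bsub>C\<^esub> (c \<star>\<^bsub>S\<^esub> d))"
      by (simp add: source.tensor_comp)
    also have "\<dots> = ar Q (\<mu> V W) \<cdot>\<^bsub>C\<^esub> ((ar Q (c \<star>\<^bsub>S\<^esub> d) \<cdot>\<^bsub>C\<^esub> \<mu> V W) \<cdot>\<^bsub>C\<^esub> (c \<star>\<^bsub>S\<^esub> d))"
      by (subst mult_nat[of c d V "ob Q V" W "ob Q W"]) simp_all
    finally show ?thesis by (simp add: endo.ar_comp_arr)
  qed
  ultimately show ?thesis by (simp add: Coalg_obj)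
qed

lemma unit_coalg: "(unit S, \<eta>) \<in> Obj coalg"
  using monoidal_nat_trans.compat_unit[OF comult_monoidal] monoidal_nat_trans.compat_unit[OF counit_monoidal]
  by (simp add: Coalg_obj)

lemma mcoalg_simps [simp]:
  "ob (tensor mcoalg) ((V, c), (W, d)) = (V \<otimes>\<^bsub>S\<^esub> W, \<mu> V W \<cdot>\<^bsub>C\<^esub> (c \<star>\<^bsub>S\<^esub> d))"
  "ar (tensor mcoalg) (((V, c), (V', c'), f), ((W, d), (W', d'), g)) =
    ((V \<otimes>\<^bsub>S\<^esub> W, \<mu> V W \<cdot>\<^bsub>C\<^esub> (c \<star>\<^bsub>S\<^esub> d)), (V' \<otimes>\<^bsub>S\<^esub> W', \<mu> V' W' \<cdot>\<^bsub>C\<^esub> (c' \<star>\<^bsub>S\<^esub> d')), f \<star>\<^bsub>S\<^esub> g)"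
  "unit mcoalg = (unit S, \<eta>)"
  by (simp_all add: Coalg_monoidal_def Let_def coalg_tensor_ob_def)

lemma mcoalg_structure:
  "assoc mcoalg (U, a) (V, b) (W, c) =
    (ob (tensor mcoalg) (ob (tensor mcoalg) ((U, a), (V, b)), (W, c)),
     ob (tensor mcoalg) ((U, a), ob (tensor mcoalg) ((V, b), (W, c))), assoc S U V W)"
  "lunit mcoalg (V, b) = (ob (tensor mcoalg) ((unit S, \<eta>), (V, b)), (V, b), lunit S V)"
  "runit mcoalg (V, b) = (ob (tensor mcoalg) ((V, b), (unit S, \<eta>)), (V, b), runit S V)"
  by (simp_all add: Coalg_monoidal_def Let_def coalg_tensor_ob_def)

lemma tensor_arr:
  assumes "((V, c), (V', c'), f) \<in> Arr coalg" "((W, d), (W', d'), g) \<in> Arr coalg"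
  shows "ar (tensor mcoalg) (((V, c), (V', c'), f), ((W, d), (W', d'), g)) \<in> Arr coalg"
proof -
  have obj: "(V, c) \<in> Obj coalg" "(V', c') \<in> Obj coalg" "(W, d) \<in> Obj coalg" "(W', d') \<in> Obj coalg"
    using assms by (auto simp: Coalg_arr)
  have [simp]: "c \<in> Arr C" "Dom C c = V" "Cod C c = ob Q V" "V \<in> Obj C"
    "d \<in> Arr C" "Dom C d = W" "Cod C d = ob Q W" "W \<in> Obj C"
    "c' \<in> Arr C" "Dom C c' = V'" "Cod C c' = ob Q V'" "V' \<in> Obj C"
    "d' \<in> Arr C" "Dom C d' = W'" "Cod C d' = ob Q W'" "W' \<in> Obj C"
    "f \<in> Arr C" "Dom C f = V" "Cod C f = V'" "g \<in> Arr C" "Dom C g = W" "Cod C g = W'"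
    using assms by (auto simp: Coalg_arr Coalg_obj)
  have c'f: "c' \<cdot>\<^bsub>C\<^esub> f = ar Q f \<cdot>\<^bsub>C\<^esub> c" and d'g: "d' \<cdot>\<^bsub>C\<^esub> g = ar Q g \<cdot>\<^bsub>C\<^esub> d"
    using assms by (auto simp: Coalg_arr)
  have "\<mu> V' W' \<cdot>\<^bsub>C\<^esub> (c' \<star>\<^bsub>S\<^esub> d') \<cdot>\<^bsub>C\<^esub> (f \<star>\<^bsub>S\<^esub> g) = \<mu> V' W' \<cdot>\<^bsub>C\<^esub> (ar Q f \<star>\<^bsub>S\<^esub> ar Q g) \<cdot>\<^bsub>C\<^esub> (c \<star>\<^bsub>S\<^esub> d)"
    by (simp add: source.tensor_comp c'f d'g)
  also have "\<dots> = ar Q (f \<star>\<^bsub>S\<^esub> g) \<cdot>\<^bsub>C\<^esub> (\<mu> V W \<cdot>\<^bsub>C\<^esub> (c \<star>\<^bsub>S\<^esub> d))"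
    by (subst mult_nat[of f g V V' W W']) simp_all
  finally show ?thesis
    by (simp add: Coalg_arr tensor_obj obj)
qed

text \<open>
  The coherence axioms of the lax structure say that the structural isomorphisms commute with the
  coactions: associativity of \<open>\<mu>\<close> gives the associator, the unit laws of \<open>\<eta>\<close> the unitors.
\<close>

lemma assoc_coalg_arr:
  assumes "(U, a) \<in> Obj coalg" "(V, b) \<in> Obj coalg" "(W, c) \<in> Obj coalg"
  shows "assoc mcoalg (U, a) (V, b) (W, c) \<in> Arr coalg"
proof -
  have [simp]: "a \<in> Arr C" "Dom C a = U" "Cod C a = ob Q U" "U \<in> Obj C"
    "b \<in> Arr C" "Dom C b = V" "Cod C b = ob Q V" "V \<in> Obj C"
    "c \<in> Arr C" "Dom C c = W" "Cod C c = ob Q W" "W \<in> Obj C"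
    using assms by (auto simp: Coalg_obj)
  have nat: "assoc S (ob Q U) (ob Q V) (ob Q W) \<cdot>\<^bsub>C\<^esub> ((a \<star>\<^bsub>S\<^esub> b) \<star>\<^bsub>S\<^esub> c) = (a \<star>\<^bsub>S\<^esub> (b \<star>\<^bsub>S\<^esub> c)) \<cdot>\<^bsub>C\<^esub> assoc S U V W"
    by (rule source.assoc_natural) (simp_all add: hom_def)
  have "ar Q (assoc S U V W) \<cdot>\<^bsub>C\<^esub> (\<mu> (U \<otimes>\<^bsub>S\<^esub> V) W \<cdot>\<^bsub>C\<^esub> ((\<mu> U V \<cdot>\<^bsub>C\<^esub> (a \<star>\<^bsub>S\<^esub> b)) \<star>\<^bsub>S\<^esub> c)) =
      (ar Q (assoc S U V W) \<cdot>\<^bsub>C\<^esub> \<mu> (U \<otimes>\<^bsub>S\<^esub> V) W \<cdot>\<^bsub>C\<^esub> (\<mu> U V \<star>\<^bsub>S\<^esub> Ide C (ob Q W))) \<cdot>\<^bsub>C\<^esub> ((a \<star>\<^bsub>S\<^esub> b) \<star>\<^bsub>S\<^esub> c)"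
    by (simp add: source.tensor_comp)
  also have "\<dots> = \<mu> U (V \<otimes>\<^bsub>S\<^esub> W) \<cdot>\<^bsub>C\<^esub> ((Ide C (ob Q U) \<star>\<^bsub>S\<^esub> \<mu> V W) \<cdot>\<^bsub>C\<^esub>
      (assoc S (ob Q U) (ob Q V) (ob Q W) \<cdot>\<^bsub>C\<^esub> ((a \<star>\<^bsub>S\<^esub> b) \<star>\<^bsub>S\<^esub> c)))"
    by (subst mult_assoc) simp_all
  also have "\<dots> = \<mu> U (V \<otimes>\<^bsub>S\<^esub> W) \<cdot>\<^bsub>C\<^esub> (a \<star>\<^bsub>S\<^esub> (\<mu> V W \<cdot>\<^bsub>C\<^esub> (b \<star>\<^bsub>S\<^esub> c))) \<cdot>\<^bsub>C\<^esub> assoc S U V W"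
    by (simp only: nat) (simp add: source.tensor_comp_tail)
  finally show ?thesis
    by (simp add: mcoalg_structure Coalg_arr tensor_obj assms)
qed

lemma unitor_coalg_arr:
  assumes "(V, b) \<in> Obj coalg"
  shows "lunit mcoalg (V, b) \<in> Arr coalg" "runit mcoalg (V, b) \<in> Arr coalg"
proof -
  have [simp]: "b \<in> Arr C" "Dom C b = V" "Cod C b = ob Q V" "V \<in> Obj C"
    using assms by (auto simp: Coalg_obj)
  have "ar Q (lunit S V) \<cdot>\<^bsub>C\<^esub> (\<mu> (unit S) V \<cdot>\<^bsub>C\<^esub> (\<eta> \<star>\<^bsub>S\<^esub> b)) =
      (ar Q (lunit S V) \<cdot>\<^bsub>C\<^esub> \<mu> (unit S) V \<cdot>\<^bsub>C\<^esub> (\<eta> \<star>\<^bsub>S\<^esub> Ide C (ob Q V))) \<cdot>\<^bsub>C\<^esub> (Ide C (unit S) \<star>\<^bsub>S\<^esub> b)"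
    by (simp add: source.tensor_comp)
  also have "\<dots> = b \<cdot>\<^bsub>C\<^esub> lunit S V"
    by (simp only: mult_lunit \<open>V \<in> Obj C\<close>) (rule source.lunit_natural, simp add: hom_def)
  finally show "lunit mcoalg (V, b) \<in> Arr coalg"
    using tensor_obj[OF unit_coalg assms] by (simp add: mcoalg_structure Coalg_arr assms)
  have "ar Q (runit S V) \<cdot>\<^bsub>C\<^esub> (\<mu> V (unit S) \<cdot>\<^bsub>C\<^esub> (b \<star>\<^bsub>S\<^esub> \<eta>)) =
      (ar Q (runit S V) \<cdot>\<^bsub>C\<^esub> \<mu> V (unit S) \<cdot>\<^bsub>C\<^esub> (Ide C (ob Q V) \<star>\<^bsub>S\<^esub> \<eta>)) \<cdot>\<^bsub>C\<^esub> (b \<star>\<^bsub>S\<^esub> Ide C (unit S))"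
    by (simp add: source.tensor_comp)
  also have "\<dots> = b \<cdot>\<^bsub>C\<^esub> runit S V"
    by (simp only: mult_runit \<open>V \<in> Obj C\<close>) (rule source.runit_natural, simp add: hom_def)
  finally show "runit mcoalg (V, b) \<in> Arr coalg"
    using tensor_obj[OF assms unit_coalg] by (simp add: mcoalg_structure Coalg_arr assms)
qed

lemma coalg_tensor_functor: "is_functor (prod_cat coalg coalg) coalg (tensor mcoalg)"
proof -
  interpret coalg: category coalg by (rule category_Coalg)
  interpret cc: category "prod_cat coalg coalg" by (rule category_prod) unfold_locales
  show ?thesis
  proof
    fix X assume "X \<in> Obj (prod_cat coalg coalg)"
    then obtain V c W d where "X = ((V, c), (W, d))" "(V, c) \<in> Obj coalg" "(W, d) \<in> Obj coalg"
      by (cases X) auto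
    then show "ob (tensor mcoalg) X \<in> Obj coalg"
      and "ar (tensor mcoalg) (Ide (prod_cat coalg coalg) X) = Ide coalg (ob (tensor mcoalg) X)"
      by (simp add: tensor_obj, simp add: Coalg_obj)
  next
    fix f X Y assume "f \<in> hom (prod_cat coalg coalg) X Y"
    then obtain V c V' c' W d W' d' g h where "X = ((V, c), (W, d))" "Y = ((V', c'), (W', d'))"
      "f = (((V, c), (V', c'), g), ((W, d), (W', d'), h))"
      "((V, c), (V', c'), g) \<in> Arr coalg" "((W, d), (W', d'), h) \<in> Arr coalg"
      by (cases f; cases X; cases Y) (auto simp: Coalg_hom)
    then show "ar (tensor mcoalg) f \<in> hom coalg (ob (tensor mcoalg) X) (ob (tensor mcoalg) Y)"
      using tensor_arr[of V c V' c' g W d W' d' h] by (simp add: hom_def)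
  next
    fix f X Y g Z
    assume "f \<in> hom (prod_cat coalg coalg) X Y" "g \<in> hom (prod_cat coalg coalg) Y Z"
    then show "ar (tensor mcoalg) (g \<cdot>\<^bsub>prod_cat coalg coalg\<^esub> f) = ar (tensor mcoalg) g \<cdot>\<^bsub>coalg\<^esub> ar (tensor mcoalg) f"
      by (cases f; cases g; cases X; cases Y; cases Z)
        (auto simp: Coalg_hom Coalg_arr source.tensor_comp)
  qed
qed

text \<open>
  Pentagon, triangle and naturality are equations between underlying arrows, hence inherited from
  \<open>C\<close>.
\<close>

theorem Coalg_monoidal_category: "monoidal_category coalg mcoalg"
proof (intro monoidal_category.intro monoidal_category_axioms.intro category_Coalg coalg_tensor_functor)
  show "unit mcoalg \<in> Obj coalg" by (simp add: unit_coalg)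
next
  fix X Y Z assume "X \<in> Obj coalg" "Y \<in> Obj coalg" "Z \<in> Obj coalg"
  moreover obtain U a V b W c where "X = (U, a)" "Y = (V, b)" "Z = (W, c)"
    by (cases X; cases Y; cases Z)
  moreover have "U \<in> Obj C" "V \<in> Obj C" "W \<in> Obj C"
    using calculation by (auto simp: Coalg_obj)
  ultimately show "assoc mcoalg X Y Z \<in>
      hom coalg (ob (tensor mcoalg) (ob (tensor mcoalg) (X, Y), Z)) (ob (tensor mcoalg) (X, ob (tensor mcoalg) (Y, Z)))"
    and "is_iso coalg (assoc mcoalg X Y Z)"
    using assoc_coalg_arr[of U a V b W c]
    by (auto simp: mcoalg_structure hom_def intro: Coalg_iso source.assoc_iso)
next
  fix X assume "X \<in> Obj coalg"
  moreover obtain V b where "X = (V, b)" by (cases X)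
  moreover have "V \<in> Obj C" using calculation by (auto simp: Coalg_obj)
  ultimately show "lunit mcoalg X \<in> hom coalg (ob (tensor mcoalg) (unit mcoalg, X)) X"
    and "runit mcoalg X \<in> hom coalg (ob (tensor mcoalg) (X, unit mcoalg)) X"
    and "is_iso coalg (lunit mcoalg X)" and "is_iso coalg (runit mcoalg X)"
    using unitor_coalg_arr[of V b]
    by (auto simp: mcoalg_structure hom_def intro: Coalg_iso source.lunit_iso source.runit_iso)
next
  fix f X X' g Y Y' h Z Z'
  assume "f \<in> hom coalg X X'" "g \<in> hom coalg Y Y'" "h \<in> hom coalg Z Z'"
  then show "assoc mcoalg X' Y' Z' \<cdot>\<^bsub>coalg\<^esub> ar (tensor mcoalg) (ar (tensor mcoalg) (f, g), h) =
      ar (tensor mcoalg) (f, ar (tensor mcoalg) (g, h)) \<cdot>\<^bsub>coalg\<^esub> assoc mcoalg X Y Z"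
    by (cases X; cases X'; cases Y; cases Y'; cases Z; cases Z')
      (auto simp: mcoalg_structure Coalg_hom Coalg_arr intro!: source.assoc_natural, auto simp: hom_def)
next
  fix f X X' assume "f \<in> hom coalg X X'"
  then show "lunit mcoalg X' \<cdot>\<^bsub>coalg\<^esub> ar (tensor mcoalg) (Ide coalg (unit mcoalg), f) = f \<cdot>\<^bsub>coalg\<^esub> lunit mcoalg X"
    and "runit mcoalg X' \<cdot>\<^bsub>coalg\<^esub> ar (tensor mcoalg) (f, Ide coalg (unit mcoalg)) = f \<cdot>\<^bsub>coalg\<^esub> runit mcoalg X"
    by - (cases X; cases X'; auto simp: mcoalg_structure Coalg_hom Coalg_arr
        intro!: source.lunit_natural source.runit_natural, auto simp: hom_def)+
next
  fix W X Y Z assume "W \<in> Obj coalg" "X \<in> Obj coalg" "Y \<in> Obj coalg" "Z \<in> Obj coalg"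
  then show "assoc mcoalg W X (ob (tensor mcoalg) (Y, Z)) \<cdot>\<^bsub>coalg\<^esub> assoc mcoalg (ob (tensor mcoalg) (W, X)) Y Z =
      ar (tensor mcoalg) (Ide coalg W, assoc mcoalg X Y Z) \<cdot>\<^bsub>coalg\<^esub> assoc mcoalg W (ob (tensor mcoalg) (X, Y)) Z \<cdot>\<^bsub>coalg\<^esub>
        ar (tensor mcoalg) (assoc mcoalg W X Y, Ide coalg Z)"
    by (cases W; cases X; cases Y; cases Z) (auto simp: mcoalg_structure Coalg_obj source.pentagon)
next
  fix X Y assume "X \<in> Obj coalg" "Y \<in> Obj coalg"
  then show "ar (tensor mcoalg) (Ide coalg X, lunit mcoalg Y) \<cdot>\<^bsub>coalg\<^esub> assoc mcoalg X (unit mcoalg) Y =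
      ar (tensor mcoalg) (runit mcoalg X, Ide coalg Y)"
    by (cases X; cases Y) (auto simp: mcoalg_structure Coalg_obj source.triangle)
qed

end

section \<open>The enrichment of algebras over coalgebras\<close>

context enriched_tensored_cotensored
begin

lemma cot_bifunctor: "bifunctor D (op_cat E) D (cot K)"
  using cotensor
  by (intro bifunctor.intro category_op base.category_axioms category_axioms)
    (simp add: cotensorisation_def)

text \<open>
  The two natural bijections of an enriched, tensored and cotensored category, read as universal
  arrows.  By naturality, transposing an arrow amounts to composing its image with the transpose of
  an identity: of \<open>V \<boxtimes> X\<close> here, of \<open>{X, Y}\<close> in the lemma that follows.
\<close>

lemma tensor_universal_arrows:
  assumes V: "V \<in> Obj E"
  shows "has_universal_arrows D D (slice (op_cat E) (swap_args (cot K)) V)"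
  unfolding has_universal_arrows_def
proof
  fix X assume X: "X \<in> Obj D"
  interpret T: bifunctor E D D T
    by (intro bifunctor.intro tensor_bifunctor base.category_axioms category_axioms)
  interpret H: bifunctor "op_cat D" D E H
    by (intro bifunctor.intro hom_bifunctor category_op category_axioms)
  interpret K: bifunctor D "op_cat E" D "cot K" by (rule cot_bifunctor)
  define L where "L = ob T (V, X)"
  have L: "L \<in> Obj D" using V X by (simp add: L_def)
  have idL: "Ide D L \<in> hom D (ob T (V, X)) L" using id_hom[OF L] by (simp add: L_def)
  let ?id = "\<phi> V X L (Ide D L)"
  have id: "?id \<in> hom E V (ob H (X, L))"
    using bij_betwE[OF tensor_hom_bij[OF V X L]] idL by blast
  define u where "u = \<psi> V X L ?id"
  have u: "u \<in> hom D X (ob (cot K) (L, V))"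
    using bij_betwE[OF hom_cotensor_bij[OF V X L]] id by (simp add: u_def)
  have transpose: "ar (cot K) (g, Ide E V) \<cdot>\<^bsub>D\<^esub> u = \<psi> V X Y (\<phi> V X Y g)"
    if g: "g \<in> hom D L Y" and Y: "Y \<in> Obj D" for g Y
  proof -
    have [simp]: "g \<in> Arr D" "Dom D g = L" "Cod D g = Y" using g by (auto simp: hom_def)
    have [simp]: "?id \<in> Arr E" "Dom E ?id = V" "Cod E ?id = ob H (X, L)" using id by (auto simp: hom_def)
    have [simp]: "u \<in> Arr D" "Dom D u = X" "Cod D u = ob (cot K) (L, V)" using u by (auto simp: hom_def)
    have "\<phi> V X Y g = ar H (Ide D X, g) \<cdot>\<^bsub>E\<^esub> ?id"
      using tensor_hom_natural[OF base.id_hom[OF V] id_hom[OF X] g idL]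
        V X L Y
      by (simp add: L_def[symmetric])
    moreover have "\<psi> V X Y (ar H (Ide D X, g) \<cdot>\<^bsub>E\<^esub> ?id) = ar (cot K) (g, Ide E V) \<cdot>\<^bsub>D\<^esub> u"
      using hom_cotensor_natural[OF base.id_hom[OF V] id_hom[OF X] g id] V X L Y
      by (simp add: u_def[symmetric])
    ultimately show ?thesis by simp
  qed
  have "universal_arrow D D (slice (op_cat E) (swap_args (cot K)) V) X L u"
  proof (rule universal_arrowI[OF L])
    fix Y f assume Y: "Y \<in> Obj D" and f: "f \<in> hom D X (ob (slice (op_cat E) (swap_args (cot K)) V) Y)"
    have "bij_betw (\<lambda>g. \<psi> V X Y (\<phi> V X Y g)) (hom D L Y) (hom D X (ob (cot K) (Y, V)))"
      using bij_betw_trans[OF tensor_hom_bij[OF V X Y] hom_cotensor_bij[OF V X Y]]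
      by (simp add: L_def comp_def)
    then have "bij_betw (\<lambda>g. ar (cot K) (g, Ide E V) \<cdot>\<^bsub>D\<^esub> u) (hom D L Y) (hom D X (ob (cot K) (Y, V)))"
      by (rule bij_betw_cong[THEN iffD2, rotated]) (rule transpose[OF _ Y])
    then show "\<exists>!g. g \<in> hom D L Y \<and> ar (slice (op_cat E) (swap_args (cot K)) V) g \<cdot>\<^bsub>D\<^esub> u = f"
      using f unfolding bij_betw_def inj_on_def by (simp add: set_eq_iff image_iff) metis
  qed (use u in simp)
  then show "\<exists>L u. universal_arrow D D (slice (op_cat E) (swap_args (cot K)) V) X L u" by blast
qed

lemma hom_universal_arrows:
  assumes Y: "Y \<in> Obj D"
  shows "has_universal_arrows (op_cat E) D (slice D (cot K) Y)"
  unfolding has_universal_arrows_def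
proof
  fix X assume X: "X \<in> Obj D"
  interpret H: bifunctor "op_cat D" D E H
    by (intro bifunctor.intro hom_bifunctor category_op category_axioms)
  interpret K: bifunctor D "op_cat E" D "cot K" by (rule cot_bifunctor)
  define L where "L = ob H (X, Y)"
  have L: "L \<in> Obj E" using X Y by (simp add: L_def)
  define u where "u = \<psi> L X Y (Ide E L)"
  have id: "Ide E L \<in> hom E L (ob H (X, Y))" using base.id_hom[OF L] by (simp add: L_def)
  have u: "u \<in> hom D X (ob (cot K) (Y, L))"
    using bij_betwE[OF hom_cotensor_bij[OF L X Y]] id by (simp add: u_def)
  have transpose: "ar (cot K) (Ide D Y, h) \<cdot>\<^bsub>D\<^esub> u = \<psi> V X Y h" if h: "h \<in> hom E V L" for h V
  proof -
    have [simp]: "h \<in> Arr E" "Dom E h = V" "Cod E h = L" using h by (auto simp: hom_def)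
    have [simp]: "u \<in> Arr D" "Dom D u = X" "Cod D u = ob (cot K) (Y, L)" using u by (auto simp: hom_def)
    show ?thesis
      using hom_cotensor_natural[OF h id_hom[OF X] id_hom[OF Y] id] X Y L H.bi_id[of X Y]
      by (simp add: u_def[symmetric] L_def[symmetric])
  qed
  have "universal_arrow (op_cat E) D (slice D (cot K) Y) X L u"
  proof (rule universal_arrowI)
    fix V f assume V: "V \<in> Obj (op_cat E)" and f: "f \<in> hom D X (ob (slice D (cot K) Y) V)"
    have "bij_betw (\<psi> V X Y) (hom E V L) (hom D X (ob (cot K) (Y, V)))"
      using hom_cotensor_bij[of V X Y] V X Y by (simp add: L_def)
    then have "bij_betw (\<lambda>h. ar (cot K) (Ide D Y, h) \<cdot>\<^bsub>D\<^esub> u) (hom E V L) (hom D X (ob (cot K) (Y, V)))"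
      by (rule bij_betw_cong[THEN iffD2, rotated]) (rule transpose)
    then show "\<exists>!g. g \<in> hom (op_cat E) L V \<and> ar (slice D (cot K) Y) g \<cdot>\<^bsub>D\<^esub> u = f"
      using f unfolding bij_betw_def inj_on_def by (simp add: set_eq_iff image_iff) metis
  qed (use u L in simp_all)
  then show "\<exists>L u. universal_arrow (op_cat E) D (slice D (cot K) Y) X L u" by blast
qed

end

theorem theorem6:
  fixes C :: "('co, 'ca) cat" and S :: "('co, 'ca) monoidal"
    and D :: "('do, 'da) cat"
    and T :: "('co \<times> 'do, 'ca \<times> 'da, 'do, 'da) funct"
    and H :: "('do \<times> 'do, 'da \<times> 'da, 'co, 'ca) funct"
    and K :: "('co, 'ca, 'do, 'da) cotensoring"
    and \<phi> :: "'co \<Rightarrow> 'do \<Rightarrow> 'do \<Rightarrow> 'da \<Rightarrow> 'ca"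
    and \<psi> :: "'co \<Rightarrow> 'do \<Rightarrow> 'do \<Rightarrow> 'ca \<Rightarrow> 'da"
    and Q :: "('co, 'ca, 'co, 'ca) funct"
    and w n :: "'co \<Rightarrow> 'ca" and \<mu> :: "'co \<Rightarrow> 'co \<Rightarrow> 'ca" and \<eta> :: "'ca"
    and M :: "('do, 'da, 'do, 'da) funct" and m e :: "'do \<Rightarrow> 'da"
    and K' :: "(('co, 'ca) str, ('co, 'ca) str_arr, ('do, 'da) str, ('do, 'da) str_arr) cotensoring"
  assumes "monoidal_category C S"
    and "has_coreflexive_equalisers C"
    and "enriched_tensored_cotensored C S D T H K \<phi> \<psi>"
    and "has_coreflexive_equalisers D"
    and "has_reflexive_coequalisers D"
    and "hopf_comonad C S Q w n \<mu> \<eta>"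
    and "preserves_coreflexive_equalisers C C Q"
    and "monad D M m e"
    and "preserves_reflexive_coequalisers D D M"
    and "cotensorisation (Coalg C Q w n) (Coalg_monoidal C S \<mu> \<eta>) (Alg D M m e) K'"
    and "lifts_cotensorisation (Coalg C Q w n) (Alg D M m e) forget forget K' K"
  shows "\<exists>T' H' \<phi>' \<psi>'. enriched_tensored_cotensored
    (Coalg C Q w n) (Coalg_monoidal C S \<mu> \<eta>) (Alg D M m e) T' H' K' \<phi>' \<psi>'"
proof -
  interpret K: enriched_tensored_cotensored C S D T H K \<phi> \<psi> by fact
  interpret Q: hopf_comonad C S Q w n \<mu> \<eta> by fact
  interpret M: monad D M m e by fact
  let ?E = "Coalg C Q w n" and ?A = "Alg D M m e"
  interpret E: category ?E by (rule Q.category_Coalg)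
  interpret A: category ?A by (rule M.category_Alg)
  interpret Kb: bifunctor D "op_cat C" D "cot K" by (rule K.cot_bifunctor)
  interpret K': bifunctor ?A "op_cat ?E" ?A "cot K'"
    using assms(10)
    by (intro bifunctor.intro category_op E.category_axioms A.category_axioms)
      (simp add: cotensorisation_def)
  interpret Kb_swap: bifunctor "op_cat C" D D "swap_args (cot K)"
    by (intro bifunctor.intro Kb.functor_swap category_op K.base.category_axioms K.category_axioms)
  interpret K'_swap: bifunctor "op_cat ?E" ?A ?A "swap_args (cot K')"
    by (intro bifunctor.intro K'.functor_swap category_op E.category_axioms A.category_axioms)
  have lift_ob: "fst (ob (cot K') (X, V)) = ob (cot K) (fst X, fst V)"
    if "X \<in> Obj ?A" "V \<in> Obj ?E" for X V
    using assms(11) that unfolding lifts_cotensorisation_def by simp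
  have lift_ar: "ar forget (ar (cot K') (f, v)) = ar (cot K) (ar forget f, ar forget v)"
    if "f \<in> Arr ?A" "v \<in> Arr ?E" for f v
    using assms(11) that unfolding lifts_cotensorisation_def by simp
  have A_coeq: "has_reflexive_coequalisers ?A"
    by (rule M.Alg_has_reflexive_coequalisers) fact+
  have E_coeq: "has_reflexive_coequalisers (op_cat ?E)"
    by (rule Q.op_Coalg_has_reflexive_coequalisers) fact+
  have fst_E: "fst V \<in> Obj C" if "V \<in> Obj ?E" for V
    using that by (cases V) (simp add: Coalg_obj)
  have fst_A: "fst X \<in> Obj D" if "X \<in> Obj ?A" for X
    using that by (cases X) (simp add: Alg_obj)
  \<comment> \<open>Forgetting the algebra structure of \<open>\<langle>Y, V\<rangle>\<close> gives the cotensor of the underlying objects, so each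
      composite with the forgetful functor of algebras is a composite of functors with left adjoints.\<close>
  have tens: "has_universal_arrows ?A ?A (slice (op_cat ?E) (swap_args (cot K')) V)"
    if V: "V \<in> Obj ?E" for V
  proof (rule M.adjoint_triangle[OF K'_swap.functor_slice A_coeq])
    have "has_universal_arrows ?A D (comp_funct (slice (op_cat C) (swap_args (cot K)) (fst V)) forget)"
      using fst_E[OF V]
      by (intro has_universal_arrows_comp[OF M.forget_functor Kb_swap.functor_slice
            M.forget_has_universal_arrows K.tensor_universal_arrows]) simp_all
    then show "has_universal_arrows ?A D (comp_funct forget (slice (op_cat ?E) (swap_args (cot K')) V))"
      by (rule has_universal_arrows_cong)
        (use V E.ide_arr[OF V] in \<open>simp_all add: comp_funct_def lift_ob lift_ar\<close>)
  qed (use V in simp)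
  have enr: "has_universal_arrows (op_cat ?E) ?A (slice ?A (cot K') Y)"
    if Y: "Y \<in> Obj ?A" for Y
  proof (rule M.adjoint_triangle[OF K'.functor_slice E_coeq])
    have "has_universal_arrows (op_cat ?E) D (comp_funct (slice D (cot K) (fst Y)) forget)"
      using fst_A[OF Y]
      by (intro has_universal_arrows_comp[OF Q.forget_coalg_functor Kb.functor_slice
            Q.forget_coalg_universal_arrows K.hom_universal_arrows]) simp_all
    then show "has_universal_arrows (op_cat ?E) D (comp_funct forget (slice ?A (cot K') Y))"
      by (rule has_universal_arrows_cong)
        (use Y A.ide_arr[OF Y] in \<open>simp_all add: comp_funct_def lift_ob lift_ar\<close>)
  qed (use Y in simp)
  show ?thesis
    by (rule enriched_tensored_cotensored_if_universal[OF Q.Coalg_monoidal_category assms(10) tens enr])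
qed

end
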